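(* Let $K$ be a field. For any graph $G$ and $k\geq1$, we have $$\sqrt{I(G)^{k}:I(G)^{(k)}}=\sqrt{\operatorname{Ann}_{S}\bigl(I(G)^{(k)}/I(G)^{k}\bigr)}=\bigcap_{C\in\mathcal{C}_{k}(G)}\bigl(I(G)+(x_{i} : i\in N_{G}[C])\bigr),$$ where $\mathcal{C}_{k}(G)=\{C : C\text{ is an induced odd cycle of }G\text{ with }|C|\leq 2k-1\}$.
   Context: All graphs are finite, without loops and multiple edges. For a graph $G$ on vertex set $[n]=\{1,\dots,n\}$ and the polynomial ring $S=K[x_1,\dots,x_n]$, the edge ideal is $I(G)=(x_ix_j : \{i,j\}\in E(G))\subset S$. For a squarefree monomial ideal $I$, the $k$-th symbolic power is $I^{(k)}=\bigcap_{P\in\operatorname{Min}(I)}P^k$, where $\operatorname{Min}(I)$ is the set of minimal primes of $I$; one always has $I^k\subset I^{(k)}$. For a cycle $C$, $|C|$ is its length (number of vertices), and $N_G[C]$ is the closed neighborhood in $G$ of the vertex set of $C$ (the vertices of $C$ together with all their neighbors). An intersection over the empty index set is understood to be $S$. *)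

theory Defs
  imports "HOL-Algebra.Module" "HOL-Algebra.QuotRing" "HOL-Algebra.Ideal_Product"
    "HOL-Library.Poly_Mapping"
begin

section \<open>The polynomial ring\<close>

type_synonym 'k mpoly = "(nat \<Rightarrow>\<^sub>0 nat) \<Rightarrow>\<^sub>0 'k"

text \<open>
  An element of \<^typ>\<open>'k mpoly\<close> is a polynomial in the variables \<open>x\<^sub>i\<close>, \<open>i\<close> a natural number;
  its keys are the exponent vectors of its monomials. The ring \<open>K[x\<^sub>1,\<dots>,x\<^sub>n]\<close> consists of the
  polynomials in which only \<open>x\<^sub>1,\<dots>,x\<^sub>n\<close> occur.
\<close>

definition polynomial_ring :: "nat \<Rightarrow> ('k::field) mpoly ring" where
  "polynomial_ring n =
     \<lparr>carrier = {p. \<forall>m \<in> Poly_Mapping.keys p. Poly_Mapping.keys m \<subseteq> {1..n}},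
      monoid.mult = (*), one = 1, ring.zero = 0, add = (+)\<rparr>"

definition pvar :: "nat \<Rightarrow> ('k::field) mpoly" where
  "pvar i = Poly_Mapping.single (Poly_Mapping.single i 1) 1"

lemma pvar_in_polynomial_ring: "i \<in> {1..n} \<Longrightarrow> pvar i \<in> carrier (polynomial_ring n)"
  by (simp add: pvar_def polynomial_ring_def)

lemma cring_polynomial_ring: "cring (polynomial_ring n :: ('k::field) mpoly ring)"
proof -
  have add: "\<forall>m \<in> Poly_Mapping.keys (p + q). Poly_Mapping.keys m \<subseteq> A"
    if "\<forall>m \<in> Poly_Mapping.keys p. Poly_Mapping.keys m \<subseteq> A"
      "\<forall>m \<in> Poly_Mapping.keys q. Poly_Mapping.keys m \<subseteq> A" for p q :: "'k mpoly" and A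
    using that keys_add[of p q] by blast
  have mult: "\<forall>m \<in> Poly_Mapping.keys (p * q). Poly_Mapping.keys m \<subseteq> A"
    if "\<forall>m \<in> Poly_Mapping.keys p. Poly_Mapping.keys m \<subseteq> A"
      "\<forall>m \<in> Poly_Mapping.keys q. Poly_Mapping.keys m \<subseteq> A" for p q :: "'k mpoly" and A
  proof
    fix m assume "m \<in> Poly_Mapping.keys (p * q)"
    then obtain a b where "m = a + b" "a \<in> Poly_Mapping.keys p" "b \<in> Poly_Mapping.keys q"
      using keys_mult[of p q] by blast
    then show "Poly_Mapping.keys m \<subseteq> A"
      using that keys_add[of a b] by blast
  qed
  have uminus: "\<exists>q. (\<forall>m \<in> Poly_Mapping.keys q. Poly_Mapping.keys m \<subseteq> A) \<and> q + p = 0"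
    if "\<forall>m \<in> Poly_Mapping.keys p. Poly_Mapping.keys m \<subseteq> A" for p :: "'k mpoly" and A
    using that
    by (intro exI[of _ "- p"]) (simp add: Poly_Mapping.keys.rep_eq uminus_poly_mapping.rep_eq)
  show ?thesis
  proof (rule cringI)
    show "abelian_group (polynomial_ring n :: 'k mpoly ring)"
    proof (rule abelian_groupI)
      fix p q :: "'k mpoly"
      assume "p \<in> carrier (polynomial_ring n)" "q \<in> carrier (polynomial_ring n)"
      then show "p \<oplus>\<^bsub>polynomial_ring n\<^esub> q \<in> carrier (polynomial_ring n)"
        using add[of p "{1..n}" q] by (simp add: polynomial_ring_def)
    next
      fix p :: "'k mpoly"
      assume "p \<in> carrier (polynomial_ring n)"
      then show "\<exists>q \<in> carrier (polynomial_ring n). q \<oplus>\<^bsub>polynomial_ring n\<^esub> p = \<zero>\<^bsub>polynomial_ring n\<^esub>"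
        using uminus[of p "{1..n}"] by (auto simp: polynomial_ring_def)
    qed (simp_all add: polynomial_ring_def algebra_simps)
    show "Group.comm_monoid (polynomial_ring n :: 'k mpoly ring)"
    proof (rule comm_monoidI)
      fix p q :: "'k mpoly"
      assume "p \<in> carrier (polynomial_ring n)" "q \<in> carrier (polynomial_ring n)"
      then show "p \<otimes>\<^bsub>polynomial_ring n\<^esub> q \<in> carrier (polynomial_ring n)"
        using mult[of p "{1..n}" q] by (simp add: polynomial_ring_def)
    qed (simp_all add: polynomial_ring_def algebra_simps)
  qed (simp add: polynomial_ring_def algebra_simps)
qed


section \<open>Ideals\<close>

abbreviation ideal_power :: "('a, 'b) ring_scheme \<Rightarrow> 'a set \<Rightarrow> nat \<Rightarrow> 'a set" where
  "ideal_power R I k \<equiv> I [^]\<^bsub>ideals_set R\<^esub> k"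

definition radical :: "('a, 'b) ring_scheme \<Rightarrow> 'a set \<Rightarrow> 'a set" where
  "radical R I = {f \<in> carrier R. \<exists>m::nat. f [^]\<^bsub>R\<^esub> m \<in> I}"

definition colon_ideal :: "('a, 'b) ring_scheme \<Rightarrow> 'a set \<Rightarrow> 'a set \<Rightarrow> 'a set" where
  "colon_ideal R I J = {f \<in> carrier R. \<forall>g \<in> J. f \<otimes>\<^bsub>R\<^esub> g \<in> I}"

definition minimal_primes :: "('a, 'b) ring_scheme \<Rightarrow> 'a set \<Rightarrow> 'a set set" where
  "minimal_primes R I =
     {P. primeideal P R \<and> I \<subseteq> P \<and> (\<forall>Q. primeideal Q R \<and> I \<subseteq> Q \<and> Q \<subseteq> P \<longrightarrow> Q = P)}"

text \<open>
  For squarefree monomial ideals, the only ones to which it is applied, this agrees with the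
  general definition of symbolic powers by means of localizations.
\<close>

definition symbolic_power :: "('a, 'b) ring_scheme \<Rightarrow> 'a set \<Rightarrow> nat \<Rightarrow> 'a set" where
  "symbolic_power R I k = carrier R \<inter> (\<Inter>P \<in> minimal_primes R I. ideal_power R P k)"


section \<open>Quotient modules and annihilators\<close>

definition annihilator :: "('a, 'c) ring_scheme \<Rightarrow> ('a, 'b, 'd) module_scheme \<Rightarrow> 'a set" where
  "annihilator R M = {r \<in> carrier R. \<forall>x \<in> carrier M. r \<odot>\<^bsub>M\<^esub> x = \<zero>\<^bsub>M\<^esub>}"

text \<open>
  A \<^type>\<open>module\<close> record extends a ring record; the fields \<^const>\<open>monoid.mult\<close> and \<^const>\<open>one\<close>
  play no role for modules.
\<close>

definition ideal_module :: "('a, 'b) ring_scheme \<Rightarrow> 'a set \<Rightarrow> ('a, 'a) module" where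
  "ideal_module R J =
     \<lparr>carrier = J, monoid.mult = monoid.mult R, one = one R, ring.zero = ring.zero R, add = add R,
      smult = monoid.mult R\<rparr>"

definition quotient_module :: "('a, 'b, 'c) module_scheme \<Rightarrow> 'b set \<Rightarrow> ('a, 'b set) module" where
  "quotient_module M N =
     \<lparr>carrier = a_rcosets\<^bsub>M\<^esub> N, monoid.mult = undefined,
      one = undefined, ring.zero = N, add = set_add M,
      smult = (\<lambda>r A. \<Union>x\<in>A. N +>\<^bsub>M\<^esub> (r \<odot>\<^bsub>M\<^esub> x))\<rparr>"

lemma module_ideal_module:
  fixes R (structure)
  assumes "cring R" and "ideal J R"
  shows "module R (ideal_module R J)"
proof -
  interpret cring R by fact
  interpret ideal J R by fact
  show ?thesis
  proof (rule moduleI)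
    show "abelian_group (ideal_module R J)"
      by (rule abelian_groupI)
        (auto simp: ideal_module_def a_ac I_l_closed intro!: bexI[of _ "\<ominus> _"] r_neg l_neg)
  qed (auto simp: ideal_module_def l_distr r_distr m_assoc I_l_closed is_cring)
qed

lemma module_quotient_module:
  assumes "module R M" and "submodule N R M"
  shows "module R (quotient_module M N)"
proof -
  interpret module R M by fact
  interpret N: submodule N R M by fact
  interpret N: abelian_subgroup N M
    by (rule abelian_subgroupI3) (auto simp: additive_subgroup_def M.abelian_group_axioms
        N.subgroup_axioms)
  have sub: "N \<subseteq> carrier M"
    by (rule N.a_subset)
  have smult: "(\<Union>y \<in> N +>\<^bsub>M\<^esub> x. N +>\<^bsub>M\<^esub> (r \<odot>\<^bsub>M\<^esub> y)) = N +>\<^bsub>M\<^esub> (r \<odot>\<^bsub>M\<^esub> x)"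
    if "r \<in> carrier R" "x \<in> carrier M" for r x
  proof -
    have "N +>\<^bsub>M\<^esub> (r \<odot>\<^bsub>M\<^esub> y) = N +>\<^bsub>M\<^esub> (r \<odot>\<^bsub>M\<^esub> x)" if y: "y \<in> N +>\<^bsub>M\<^esub> x" for y
    proof -
      obtain h where h: "h \<in> N" "y = h \<oplus>\<^bsub>M\<^esub> x"
        using y by (auto simp: a_r_coset_def')
      have "r \<odot>\<^bsub>M\<^esub> y = (r \<odot>\<^bsub>M\<^esub> h) \<oplus>\<^bsub>M\<^esub> (r \<odot>\<^bsub>M\<^esub> x)"
        using h that \<open>r \<in> carrier R\<close> \<open>x \<in> carrier M\<close> sub by (simp add: smult_r_distr subsetD)
      then have "r \<odot>\<^bsub>M\<^esub> y \<in> N +>\<^bsub>M\<^esub> (r \<odot>\<^bsub>M\<^esub> x)"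
        using N.smult_closed[OF \<open>r \<in> carrier R\<close> h(1)] by (auto simp: a_r_coset_def')
      then show ?thesis
        using M.a_repr_independence[OF _ _ N.subgroup_axioms] \<open>r \<in> carrier R\<close> \<open>x \<in> carrier M\<close>
        by (metis smult_closed)
    qed
    moreover have "x \<in> N +>\<^bsub>M\<^esub> x"
      using N.a_rcos_self that by simp
    ultimately show ?thesis
      by blast
  qed
  show ?thesis
  proof (rule moduleI)
    interpret Q: comm_group "M A_Mod N"
      by (rule N.a_factorgroup_is_comm_group)
    have Q: "carrier (M A_Mod N) = carrier (quotient_module M N)"
      "monoid.mult (M A_Mod N) = add (quotient_module M N)"
      "one (M A_Mod N) = ring.zero (quotient_module M N)"
      by (simp_all add: quotient_module_def A_FactGroup_def')
    show "abelian_group (quotient_module M N)"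
      by (rule abelian_groupI)
        (use Q.m_closed Q.one_closed Q.m_assoc Q.m_comm Q.l_one Q.l_inv_ex in \<open>simp_all add: Q\<close>)
  next
    have carrier: "carrier (quotient_module M N) = (\<lambda>x. N +>\<^bsub>M\<^esub> x) ` carrier M"
      by (auto simp: quotient_module_def A_RCOSETS_def')
    have scale: "r \<odot>\<^bsub>quotient_module M N\<^esub> (N +>\<^bsub>M\<^esub> x) = N +>\<^bsub>M\<^esub> (r \<odot>\<^bsub>M\<^esub> x)"
      if "r \<in> carrier R" "x \<in> carrier M" for r x
      using smult[OF that] by (simp add: quotient_module_def)
    have plus: "(N +>\<^bsub>M\<^esub> x) \<oplus>\<^bsub>quotient_module M N\<^esub> (N +>\<^bsub>M\<^esub> y) = N +>\<^bsub>M\<^esub> (x \<oplus>\<^bsub>M\<^esub> y)"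
      if "x \<in> carrier M" "y \<in> carrier M" for x y
      using N.a_rcos_sum[OF that] by (simp add: quotient_module_def)
    let ?Q = "quotient_module M N"
    show "r \<odot>\<^bsub>?Q\<^esub> A \<in> carrier ?Q"
      if "r \<in> carrier R" "A \<in> carrier ?Q" for r A
      using that by (auto simp: scale carrier)
    show "(r \<oplus>\<^bsub>R\<^esub> s) \<odot>\<^bsub>?Q\<^esub> A = r \<odot>\<^bsub>?Q\<^esub> A \<oplus>\<^bsub>?Q\<^esub> s \<odot>\<^bsub>?Q\<^esub> A"
      if "r \<in> carrier R" "s \<in> carrier R" "A \<in> carrier ?Q" for r s A
      using that by (clarsimp simp: scale plus smult_l_distr carrier)
    show "r \<odot>\<^bsub>?Q\<^esub> (A \<oplus>\<^bsub>?Q\<^esub> B) = r \<odot>\<^bsub>?Q\<^esub> A \<oplus>\<^bsub>?Q\<^esub> r \<odot>\<^bsub>?Q\<^esub> B"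
      if "r \<in> carrier R" "A \<in> carrier ?Q" "B \<in> carrier ?Q" for r A B
      using that by (clarsimp simp: scale plus smult_r_distr carrier)
    show "(r \<otimes>\<^bsub>R\<^esub> s) \<odot>\<^bsub>?Q\<^esub> A = r \<odot>\<^bsub>?Q\<^esub> (s \<odot>\<^bsub>?Q\<^esub> A)"
      if "r \<in> carrier R" "s \<in> carrier R" "A \<in> carrier ?Q" for r s A
      using that by (clarsimp simp: scale smult_assoc1 carrier)
    show "\<one>\<^bsub>R\<^esub> \<odot>\<^bsub>?Q\<^esub> A = A" if "A \<in> carrier ?Q" for A
      using that by (clarsimp simp: scale carrier)
  qed (rule is_cring)
qed


section \<open>Graphs and edge ideals\<close>

text \<open>A graph on the vertex set \<open>{1..n}\<close> is given by its set of edges, which are two-element sets.\<close>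

definition simple_graph :: "nat \<Rightarrow> nat set set \<Rightarrow> bool" where
  "simple_graph n E \<longleftrightarrow> (\<forall>e \<in> E. e \<subseteq> {1..n} \<and> card e = 2)"

definition edge_ideal :: "nat \<Rightarrow> nat set set \<Rightarrow> ('k::field) mpoly set" where
  "edge_ideal n E = Idl\<^bsub>polynomial_ring n\<^esub> {pvar i * pvar j | i j. {i, j} \<in> E}"

definition closed_neighborhood :: "nat set set \<Rightarrow> nat set \<Rightarrow> nat set" where
  "closed_neighborhood E W = W \<union> {u. \<exists>w \<in> W. {u, w} \<in> E}"

text \<open>
  A cycle is given by a list of its vertices in cyclic order. One cycle has several such lists,
  with the same vertices and length, so that an intersection over the lists is an intersection
  over the cycles.
\<close>

definition cycle_edges :: "nat list \<Rightarrow> nat set set" where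
  "cycle_edges c = {{c ! i, c ! (Suc i mod length c)} | i. i < length c}"

definition is_cycle :: "nat set set \<Rightarrow> nat list \<Rightarrow> bool" where
  "is_cycle E c \<longleftrightarrow> 3 \<le> length c \<and> distinct c \<and> cycle_edges c \<subseteq> E"

definition is_induced_cycle :: "nat set set \<Rightarrow> nat list \<Rightarrow> bool" where
  "is_induced_cycle E c \<longleftrightarrow> is_cycle E c \<and> {e \<in> E. e \<subseteq> set c} = cycle_edges c"

definition short_induced_odd_cycles :: "nat set set \<Rightarrow> nat \<Rightarrow> nat list set" where
  "short_induced_odd_cycles E k =
     {c. is_induced_cycle E c \<and> odd (length c) \<and> length c \<le> 2 * k - 1}"

end

theory Submission
  imports Defs
begin

text \<open>
  All ideals involved are spanned by monomials, so everything reduces to weights \<open>a\<close> on the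
  vertices, the exponent vectors. The monomial \<open>x\<^sup>a\<close> lies in \<open>I\<^sup>k\<close> iff \<open>k\<close> edges, taken with
  multiplicity, can be packed into \<open>a\<close> (\<open>power_edge_ideal\<close>). The minimal primes of \<open>I\<close> are
  generated by the minimal vertex covers, so \<open>x\<^sup>a\<close> lies in \<open>I\<^bsup>(k)\<^esup>\<close> iff every vertex cover
  has \<open>a\<close>-weight at least \<open>k\<close> (\<open>symbolic_power_edge_ideal\<close>). The ideals of the intersection
  consist of the polynomials each of whose monomials has a support that contains an edge or meets
  \<open>N[C]\<close> (\<open>edge_ideal_plus_variables\<close>).

  The radical is contained in the intersection: let \<open>C\<close> have length \<open>2l + 1 \<le> 2k - 1\<close>. The product
  of the variables on \<open>C\<close> and of \<open>k - l - 1\<close> copies of one of its edges lies in \<open>I\<^bsup>(k)\<^esup>\<close>, as a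
  cover contains \<open>l + 1\<close> vertices of \<open>C\<close>; but its degree is only \<open>2k - 1\<close>. If a monomial \<open>u\<close> of
  \<open>f\<close> has an independent support outside \<open>N[C]\<close>, then each power of \<open>f\<close> has a monomial \<open>w\<close> on
  that support, and multiplication by \<open>w\<close> creates no new packable edge. So no power of \<open>f\<close> moves
  the product into \<open>I\<^sup>k\<close> (\<open>odd_cycle_obstruction\<close>).

  Conversely, each monomial of a high power of \<open>f\<close> is a multiple of \<open>u\<^sup>k\<close> for some monomial \<open>u\<close>
  of \<open>f\<close>, by the pigeonhole principle. It remains to pack \<open>k\<close> edges into a weight \<open>w\<close> all of whose
  covers have weight at least \<open>k\<close> and which is at least \<open>k\<close> on the support \<open>B\<close> of \<open>u\<close>
  (\<open>packs_if_meets_short_cycles\<close>). Edges that meet \<open>B\<close> can be split off greedily. When none is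
  left, \<open>B\<close> is independent and the edges inside the support of \<open>w\<close> avoid \<open>N[B]\<close>. They either form a bipartite graph, and
  Koenig's theorem for weighted vertices finishes the proof (\<open>packs_if_bipartite\<close>), or they contain
  an induced odd cycle \<open>C\<close>. Then \<open>N[C]\<close> misses \<open>B\<close>, so \<open>C\<close> has length at least \<open>2k + 1\<close> by
  assumption and carries \<open>k\<close> disjoint edges.

  The annihilator of the quotient module is literally the colon ideal
  (\<open>annihilator_quotient_eq_colon_ideal\<close>).
\<close>

section \<open>Packings of edges and vertex covers\<close>

definition vertex_cover :: "'v set set \<Rightarrow> 'v set \<Rightarrow> bool" where
  "vertex_cover E W \<longleftrightarrow> (\<forall>e \<in> E. e \<inter> W \<noteq> {})"

text \<open>
  \<open>packs E k a\<close> says that some multiset of \<open>k\<close> edges covers each vertex \<open>x\<close> at most \<open>a x\<close> times: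
  the weighted form of a matching of size \<open>k\<close>. Splitting off one edge at a time mirrors the recursion
  for powers of an ideal.
\<close>

fun packs :: "'v set set \<Rightarrow> nat \<Rightarrow> ('v \<Rightarrow> nat) \<Rightarrow> bool" where
  "packs E 0 a \<longleftrightarrow> True"
| "packs E (Suc k) a \<longleftrightarrow> (\<exists>e \<in> E. (\<forall>x \<in> e. 0 < a x) \<and> packs E k (\<lambda>x. a x - of_bool (x \<in> e)))"

lemma packs_mono:
  assumes "packs E k a" and "\<And>x. a x \<le> b x"
  shows "packs E k b"
  using assms
proof (induction k arbitrary: a b)
  case (Suc k)
  then obtain e where e: "e \<in> E" "\<forall>x \<in> e. 0 < a x" "packs E k (\<lambda>x. a x - of_bool (x \<in> e))"
    by auto
  have "packs E k (\<lambda>x. b x - of_bool (x \<in> e))"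
    using Suc.IH[OF e(3)] Suc.prems(2) by (simp add: diff_le_mono)
  moreover have "\<forall>x \<in> e. 0 < b x"
    using e(2) Suc.prems(2) by (meson less_le_trans)
  ultimately show ?case
    using e(1) by auto
qed simp

lemma sum_delete_edge:
  fixes a :: "'v \<Rightarrow> nat"
  assumes "finite W" and "\<forall>x \<in> e. 0 < a x"
  shows "sum a W = (\<Sum>x\<in>W. a x - of_bool (x \<in> e)) + card (W \<inter> e)"
proof -
  have "sum a W = (\<Sum>x\<in>W. (a x - of_bool (x \<in> e)) + of_bool (x \<in> e))"
    using assms(2) by (intro sum.cong) (auto simp: Suc_leI)
  also have "\<dots> = (\<Sum>x\<in>W. a x - of_bool (x \<in> e)) + (\<Sum>x\<in>W. of_bool (x \<in> e))"
    by (rule sum.distrib)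
  also have "(\<Sum>x\<in>W. of_bool (x \<in> e)) = card (W \<inter> e)"
    using assms(1) by (simp add: Int_def)
  finally show ?thesis .
qed

text \<open>
  A packing of \<open>k\<close> edges uses \<open>2 k\<close> units of weight, two for each edge. If all packable edges lie in
  \<open>C\<close>, then these units must be found inside \<open>C\<close>.
\<close>

lemma packs_weight_lower_bound:
  assumes "packs E k a" and "finite C"
    and "\<And>e. e \<in> E \<Longrightarrow> card e = 2"
    and "\<And>e. e \<in> E \<Longrightarrow> \<forall>x \<in> e. 0 < a x \<Longrightarrow> e \<subseteq> C"
  shows "2 * k \<le> sum a C"
  using assms(1,4)
proof (induction k arbitrary: a)
  case (Suc k)
  then obtain e where e: "e \<in> E" "\<forall>x \<in> e. 0 < a x" "packs E k (\<lambda>x. a x - of_bool (x \<in> e))"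
    by auto
  have "2 * k \<le> (\<Sum>x\<in>C. a x - of_bool (x \<in> e))"
  proof (rule Suc.IH[OF e(3)])
    fix e' assume "e' \<in> E" "\<forall>x \<in> e'. 0 < a x - of_bool (x \<in> e)"
    then show "e' \<subseteq> C"
      by (intro Suc.prems(2)) auto
  qed
  moreover have "C \<inter> e = e"
    using Suc.prems(2) e by blast
  ultimately show ?case
    using sum_delete_edge[OF assms(2) e(2)] assms(3)[OF e(1)] by simp
qed simp

text \<open>
  Every second edge of a path is taken; these edges are disjoint, so weight one on each vertex is
  enough.
\<close>

lemma packs_path:
  assumes "distinct c" and "\<forall>x \<in> set c. 0 < a x"
    and "\<And>i. Suc i < length c \<Longrightarrow> {c ! i, c ! Suc i} \<in> E" and "2 * k \<le> length c"
  shows "packs E k a"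
  using assms
proof (induction k arbitrary: c a)
  case (Suc k)
  then obtain x y d where c: "c = x # y # d"
    by (cases c; cases "tl c") auto
  have "packs E k (\<lambda>z. a z - of_bool (z \<in> {x, y}))"
  proof (rule Suc.IH[of d])
    show "{d ! i, d ! Suc i} \<in> E" if "Suc i < length d" for i
      using Suc.prems(3)[of "Suc (Suc i)"] that c by simp
  qed (use Suc.prems c in auto)
  moreover have "{x, y} \<in> E" "\<forall>z \<in> {x, y}. 0 < a z"
    using Suc.prems(2) Suc.prems(3)[of 0] c by simp_all
  ultimately show ?case
    unfolding packs.simps by blast
qed simp

section \<open>Koenig's theorem for weighted vertices\<close>

text \<open>
  The proof splits off an edge that lowers the minimal weight of a cover by at most one. If no edge
  can be split off, then every edge with positive weights lies inside some cover of the minimal weight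
  \<open>Suc k\<close>. For a fixed vertex \<open>u\<close>, the minimal covers that contain \<open>u\<close> are closed under a lattice
  operation, namely intersection on the side of \<open>u\<close> and union on the other side \<open>Y\<close>. Hence a single
  one of them, \<open>W0\<close>, contains all neighbours of \<open>u\<close> of positive weight. Then \<open>u\<close> can be dropped
  from it, which contradicts minimality.
\<close>

lemma packs_if_bipartite:
  fixes a :: "'v \<Rightarrow> nat" and col :: "'v \<Rightarrow> bool"
  assumes V: "finite V" "\<And>e. e \<in> E \<Longrightarrow> e \<subseteq> V" "\<And>e. e \<in> E \<Longrightarrow> card e = 2"
    and col: "\<And>u v. {u, v} \<in> E \<Longrightarrow> 0 < a u \<Longrightarrow> 0 < a v \<Longrightarrow> col u \<noteq> col v"
    and cover: "\<And>W. W \<subseteq> V \<Longrightarrow> vertex_cover E W \<Longrightarrow> k \<le> sum a W"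
  shows "packs E k a"
  using col cover
proof (induction k arbitrary: a)
  case (Suc k)
  show ?case
  proof (rule ccontr)
    assume notpacks: "\<not> packs E (Suc k) a"
    \<comment> \<open>Vertices of weight zero can be added to a cover for free.\<close>
    define Z where "Z = {x \<in> V. a x = 0}"
    have Z: "sum a (W \<union> Z) = sum a W" if "W \<subseteq> V" for W
      using that V(1) by (intro sum.mono_neutral_right) (auto simp: Z_def intro: finite_subset)
    \<comment> \<open>If removing \<open>e\<close> pushes some cover below \<open>k\<close>, it takes away two units at once.\<close>
    have tight: "\<exists>W \<subseteq> V. vertex_cover E W \<and> e \<subseteq> W \<and> sum a W = Suc k"
      if e: "e \<in> E" "\<forall>x \<in> e. 0 < a x" for e
    proof -
      let ?b = "\<lambda>x. a x - of_bool (x \<in> e)"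
      have "\<not> packs E k ?b"
        using notpacks e unfolding packs.simps by blast
      moreover have "col u \<noteq> col v" if "{u, v} \<in> E" "0 < ?b u" "0 < ?b v" for u v
        using Suc.prems(1)[OF that(1)] that by simp
      ultimately obtain W where W: "W \<subseteq> V" "vertex_cover E W" "\<not> k \<le> sum ?b W"
        using Suc.IH[of ?b] by blast
      have "finite W" "finite e"
        using W(1) V e(1) finite_subset by metis+
      then have "sum a W = sum ?b W + card (W \<inter> e)"
        using e(2) by (intro sum_delete_edge)
      moreover have "Suc k \<le> sum a W"
        using Suc.prems(2) W by blast
      moreover have le: "card (W \<inter> e) \<le> card e"
        using \<open>finite e\<close> by (simp add: card_mono)
      ultimately have "card (W \<inter> e) = card e" "sum a W = Suc k"
        using W(3) V(3)[OF e(1)] by linarith+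
      then have "e \<subseteq> W"
        using \<open>finite e\<close> by (metis card_subset_eq inf.orderI inf_commute inf_le2)
      then show ?thesis
        using W \<open>sum a W = Suc k\<close> by blast
    qed
    have "\<exists>e \<in> E. \<forall>x \<in> e. 0 < a x"
    proof (rule ccontr)
      assume "\<not> ?thesis"
      then have "vertex_cover E Z"
        using V(2) by (fastforce simp: vertex_cover_def Z_def)
      then have "Suc k \<le> sum a Z"
        by (intro Suc.prems(2)) (auto simp: Z_def)
      then show False
        by (simp add: Z_def)
    qed
    then obtain e u where e: "e \<in> E" "\<forall>x \<in> e. 0 < a x" "u \<in> e"
      using V(3) by (metis card.empty equals0I zero_neq_numeral)
    define Y where "Y = {y. col y \<noteq> col u}"
    define P where "P W \<longleftrightarrow> W \<subseteq> V \<and> vertex_cover E W \<and> u \<in> W \<and> sum a W = Suc k" for W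
    \<comment> \<open>\<open>W0\<close> is maximal on the side opposite to \<open>u\<close>, so that unions there with other covers do not enlarge it.\<close>
    obtain W1 where "P W1"
      using tight[OF e(1,2)] e(3) unfolding P_def by blast
    moreover have "\<forall>W. P W \<longrightarrow> card (W \<inter> Y) < Suc (card V)"
    proof (intro allI impI)
      fix W assume "P W"
      then have "W \<inter> Y \<subseteq> V"
        unfolding P_def by blast
      then show "card (W \<inter> Y) < Suc (card V)"
        using card_mono[OF V(1)] by (simp add: less_Suc_eq_le)
    qed
    ultimately have "\<exists>W. P W \<and> (\<forall>W'. P W' \<longrightarrow> card (W' \<inter> Y) \<le> card (W \<inter> Y))"
      by (rule ex_has_greatest_nat)
    then obtain W0 where W0: "P W0" "\<And>W. P W \<Longrightarrow> card (W \<inter> Y) \<le> card (W0 \<inter> Y)"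
      by blast
    have nbr: "v \<in> W0" if v: "{u, v} \<in> E" "0 < a v" for v
    proof -
      have "0 < a u"
        using e by blast
      then obtain W where W: "W \<subseteq> V" "vertex_cover E W" "{u, v} \<subseteq> W" "sum a W = Suc k"
        using tight[OF v(1)] v(2) by blast
      have W0': "W0 \<subseteq> V" "vertex_cover E W0" "u \<in> W0" "sum a W0 = Suc k"
        using W0(1) unfolding P_def by auto
      have v': "v \<in> Y"
        using Suc.prems(1)[OF v(1) \<open>0 < a u\<close> v(2)] by (auto simp: Y_def)
      \<comment> \<open>The meet \<open>J\<close> and the join \<open>M\<close> of the two minimal covers.\<close>
      define J where "J = (W0 \<inter> W - Y) \<union> ((W0 \<union> W) \<inter> Y)"
      define M where "M = ((W0 \<union> W) - Y) \<union> (W0 \<inter> W \<inter> Y)"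
      have JM: "J \<subseteq> V" "M \<subseteq> V"
        using W(1) W0'(1) by (auto simp: J_def M_def)
      have "(J \<union> Z) \<inter> d \<noteq> {} \<and> (M \<union> Z) \<inter> d \<noteq> {}" if d: "d \<in> E" for d
      proof -
        obtain x y where xy: "d = {x, y}"
          using V(3)[OF d] by (auto simp: card_2_iff)
        have "x \<in> V" "y \<in> V"
          using V(2)[OF d] xy by auto
        moreover have "{x, y} \<inter> W \<noteq> {}" "{x, y} \<inter> W0 \<noteq> {}"
          using W(2) W0'(2) d xy unfolding vertex_cover_def by blast+
        moreover have "a x = 0 \<or> a y = 0 \<or> (x \<in> Y \<longleftrightarrow> y \<notin> Y)"
          using Suc.prems(1)[of x y] d xy by (auto simp: Y_def)
        ultimately show ?thesis
          unfolding xy J_def M_def Z_def by blast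
      qed
      then have covers: "vertex_cover E (J \<union> Z)" "vertex_cover E (M \<union> Z)"
        unfolding vertex_cover_def by blast+
      have ZV: "Z \<subseteq> V"
        by (auto simp: Z_def)
      have "Suc k \<le> sum a J" "Suc k \<le> sum a M"
        using Suc.prems(2)[OF _ covers(1)] Suc.prems(2)[OF _ covers(2)] JM ZV by (auto simp: Z)
      moreover have "sum a J + sum a M = sum a W0 + sum a W"
      proof -
        have "J \<union> M = W0 \<union> W" "J \<inter> M = W0 \<inter> W"
          by (auto simp: J_def M_def)
        moreover have "finite J" "finite M" "finite W0" "finite W"
          using JM W(1) W0'(1) V(1) finite_subset by metis+
        ultimately show ?thesis
          using sum.union_inter[of J M a] sum.union_inter[of W0 W a] by simp
      qed
      ultimately have "sum a (J \<union> Z) = Suc k"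
        using W(4) W0'(4) JM(1) by (simp add: Z)
      moreover have "u \<in> J"
        using W(3) W0'(3) by (auto simp: J_def Y_def)
      ultimately have "P (J \<union> Z)"
        using JM ZV covers(1) by (auto simp: P_def)
      then have "card ((J \<union> Z) \<inter> Y) \<le> card (W0 \<inter> Y)"
        by (rule W0(2))
      moreover have "W0 \<inter> Y \<subseteq> (J \<union> Z) \<inter> Y" "finite ((J \<union> Z) \<inter> Y)"
        using JM ZV V(1) by (auto simp: J_def intro: finite_subset)
      ultimately have "W0 \<inter> Y = (J \<union> Z) \<inter> Y"
        using card_seteq by metis
      then show ?thesis
        using W(3) v' by (auto simp: J_def)
    qed
    have W0': "W0 \<subseteq> V" "vertex_cover E W0" "u \<in> W0" "sum a W0 = Suc k" "finite W0"
      using W0(1) V(1) finite_subset unfolding P_def by auto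
    have "d \<inter> (W0 - {u} \<union> Z) \<noteq> {}" if d: "d \<in> E" for d
    proof (cases "u \<in> d")
      case True
      then obtain v where v: "d = {u, v}" "u \<noteq> v"
        using V(3)[OF d] by (auto simp: card_2_iff)
      then have "v \<in> V"
        using V(2)[OF d] by blast
      then show ?thesis
        using nbr[of v] d v by (cases "a v = 0") (auto simp: Z_def)
    next
      case False
      then show ?thesis
        using W0'(2) d by (auto simp: vertex_cover_def)
    qed
    then have "vertex_cover E (W0 - {u} \<union> Z)"
      unfolding vertex_cover_def by blast
    then have "Suc k \<le> sum a (W0 - {u} \<union> Z)"
      using W0'(1) by (intro Suc.prems(2)) (auto simp: Z_def)
    also have "\<dots> = sum a (W0 - {u})"
      using W0'(1) by (intro Z) auto
    also have "\<dots> < sum a W0"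
      using W0'(3,5) e by (simp add: sum.remove[of W0 u])
    finally show False
      using W0'(4) by simp
  qed
qed simp

section \<open>Odd cycles\<close>

text \<open>
  Without odd closed walks, the parity of the length of the walks from a root of its component
  colours a vertex. Otherwise a shortest odd closed walk is an induced cycle: a repeated vertex or a
  chord splits it into two closed walks whose lengths have an odd sum, and the odd one is shorter.
\<close>

lemma two_colouring_or_induced_odd_cycle:
  assumes E: "\<And>e. e \<in> E \<Longrightarrow> card e = 2"
  obtains (colouring) col :: "nat \<Rightarrow> bool"
      where "\<And>u v. {u, v} \<in> E \<Longrightarrow> u \<in> U \<Longrightarrow> v \<in> U \<Longrightarrow> col u \<noteq> col v"
  | (cycle) c where "is_induced_cycle E c" "odd (length c)" "set c \<subseteq> U"
proof -
  \<comment> \<open>Powers of the relation \<open>A\<close> describe walks of a given length inside \<open>U\<close>.\<close>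
  define A where "A = {(u, v). {u, v} \<in> E \<and> u \<in> U \<and> v \<in> U}"
  have sym: "(v, u) \<in> A ^^ m" if "(u, v) \<in> A ^^ m" for u v m
    using that
  proof (induction m arbitrary: v)
    case (Suc m)
    then obtain w where "(u, w) \<in> A ^^ m" "(w, v) \<in> A"
      by auto
    then have "(v, w) \<in> A" "(w, u) \<in> A ^^ m"
      using Suc.IH by (auto simp: A_def insert_commute)
    then show ?case
      by (rule relpow_Suc_I2)
  qed auto
  have trans: "(u, w) \<in> A ^^ (l + m)" if "(u, v) \<in> A ^^ l" "(v, w) \<in> A ^^ m" for u v w l m
    using that by (auto simp: relpow_add)
  show ?thesis
  proof (cases "\<exists>m v. odd m \<and> (v, v) \<in> A ^^ m")
    case False
    define root where "root v = (SOME u. (u, v) \<in> A\<^sup>*)" for v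
    define col where "col v \<longleftrightarrow> (\<exists>m. even m \<and> (root v, v) \<in> A ^^ m)" for v
    have root: "(root v, v) \<in> A\<^sup>*" for v
      unfolding root_def by (rule someI[of _ v]) simp
    have "col u \<noteq> col v" if "{u, v} \<in> E" "u \<in> U" "v \<in> U" for u v
    proof -
      have uv: "(u, v) \<in> A ^^ 1" "(v, u) \<in> A ^^ 1"
        using that by (auto simp: A_def insert_commute)
      then have "(w, u) \<in> A\<^sup>* \<longleftrightarrow> (w, v) \<in> A\<^sup>*" for w
        by (auto intro: rtrancl_into_rtrancl)
      then have same_root: "root u = root v"
        by (simp add: root_def)
      obtain m where m: "(root u, u) \<in> A ^^ m"
        using root[of u] rtrancl_imp_relpow by metis
      have step: "(root u, v) \<in> A ^^ Suc m"
        using trans[OF m uv(1)] by simp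
      have parity: "even p \<longleftrightarrow> even q" if "(r, w) \<in> A ^^ p" "(r, w) \<in> A ^^ q" for r w p q
      proof -
        have "even (p + q)"
          using trans[OF that(1) sym[OF that(2)]] False by blast
        then show ?thesis
          by simp
      qed
      have "col u \<longleftrightarrow> even m"
        using m parity unfolding col_def by blast
      moreover have "col v \<longleftrightarrow> even (Suc m)"
        using step parity unfolding col_def same_root by blast
      ultimately show ?thesis
        by simp
    qed
    then show ?thesis
      by (rule colouring)
  next
    case True
    define m where "m = (LEAST m. odd m \<and> (\<exists>v. (v, v) \<in> A ^^ m))"
    have "odd m \<and> (\<exists>v. (v, v) \<in> A ^^ m)"
      unfolding m_def by (rule LeastI_ex) (use True in blast)
    then obtain v where m: "odd m" "(v, v) \<in> A ^^ m"
      by blast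
    have least: "m \<le> l" if "odd l" "(w, w) \<in> A ^^ l" for l w
      unfolding m_def by (rule Least_le) (use that in blast)
    obtain f where f: "f 0 = v" "f m = v" "\<And>i. i < m \<Longrightarrow> (f i, f (Suc i)) \<in> A"
      using m(2) unfolding relpow_fun_conv by blast
    have seg: "(f i, f j) \<in> A ^^ (j - i)" if "i \<le> j" "j \<le> m" for i j
      unfolding relpow_fun_conv using that f(3)
      by (intro exI[of _ "\<lambda>t. f (i + t)"]) simp
    have rest: "(f j, f i) \<in> A ^^ (m - (j - i))" if "i \<le> j" "j \<le> m" for i j
    proof -
      have "(f j, f 0) \<in> A ^^ (m - j)" "(f 0, f i) \<in> A ^^ i"
        using seg[of j m] seg[of 0 i] that f(1,2) by simp_all
      then have "(f j, f i) \<in> A ^^ (m - j + i)"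
        by (rule trans)
      moreover have "m - j + i = m - (j - i)"
        using that by simp
      ultimately show ?thesis
        by simp
    qed
    have neq: "f i \<noteq> f j" if "i < j" "j < m" for i j
    proof
      assume eq: "f i = f j"
      have "j - i + (m - (j - i)) = m"
        using that by simp
      then have "odd (j - i) \<or> odd (m - (j - i))"
        using m(1) even_add by metis
      then have "m \<le> j - i \<or> m \<le> m - (j - i)"
        using least seg[of i j] rest[of i j] eq that by (metis less_imp_le)
      then show False
        using that by linarith
    qed
    have chord: "j = Suc i \<or> i = 0 \<and> j = m - 1" if "i < j" "j < m" "(f i, f j) \<in> A" for i j
    proof (rule ccontr)
      assume no: "\<not> ?thesis"
      have "(f j, f i) \<in> A ^^ 1" "(f i, f j) \<in> A ^^ 1"
        using sym[of "f i" "f j" 1] that(3) by auto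
      then have "(f i, f i) \<in> A ^^ (j - i + 1)" "(f j, f j) \<in> A ^^ (m - (j - i) + 1)"
        using trans[of _ "f j" "j - i" _ 1] trans[of _ "f i" "m - (j - i)" _ 1] seg[of i j] rest[of i j] that
        by (metis less_imp_le)+
      moreover have "j - i + (m - (j - i)) = m"
        using that by simp
      then have "odd (j - i + 1) \<or> odd (m - (j - i) + 1)"
        using m(1) by (metis even_add odd_one)
      ultimately have "m \<le> j - i + 1 \<or> m \<le> m - (j - i) + 1"
        using least by blast
      then show False
        using that no by linarith
    qed
    have "m \<noteq> 1"
      using m(2) E[of "{v, v}"] by (auto simp: A_def)
    then have m3: "3 \<le> m"
      using m(1) by presburger
    define c where "c = map f [0..<m]"
    have len: "length c = m"
      by (simp add: c_def)
    have nth: "c ! i = f i" "c ! (Suc i mod length c) = f (Suc i)" if "i < m" for i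
      using that f(1,2) by (cases "Suc i = m"; simp add: c_def)+
    have edges: "cycle_edges c = {{f i, f (Suc i)} | i. i < m}"
      unfolding cycle_edges_def len using nth[unfolded len] by (metis (no_types, lifting))
    have "inj_on f {0..<m}"
      by (rule inj_onI) (metis atLeastLessThan_iff neq linorder_neqE_nat)
    then have "distinct c"
      by (simp add: c_def distinct_map)
    moreover have "cycle_edges c \<subseteq> E"
      unfolding edges using f(3) by (auto simp: A_def)
    moreover have "set c \<subseteq> U"
      using f(3) by (auto simp: c_def A_def)
    moreover have "e \<in> cycle_edges c" if e: "e \<in> E" "e \<subseteq> set c" for e
    proof -
      obtain x y where xy: "e = {x, y}" "x \<noteq> y"
        using E[OF e(1)] by (auto simp: card_2_iff)
      then obtain i' j' where ij': "x = f i'" "y = f j'" "i' < m" "j' < m"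
        using e(2) by (auto simp: c_def)
      define i j where "i = min i' j'" and "j = max i' j'"
      have ij: "e = {f i, f j}" "i < j" "j < m"
        using xy ij' by (auto simp: i_def j_def min_def max_def insert_commute less_le)
      have "(f i, f j) \<in> A"
        using e(1) ij f(3) by (auto simp: A_def)
      then have "j = Suc i \<or> i = 0 \<and> j = m - 1"
        using chord ij by blast
      then show ?thesis
      proof
        assume "j = Suc i"
        then show ?thesis
          using ij unfolding edges by auto
      next
        assume "i = 0 \<and> j = m - 1"
        then have "e = {f (m - 1), f (Suc (m - 1))}"
          using ij f(1,2) m3 by (auto simp: insert_commute)
        then show ?thesis
          using m3 unfolding edges by (intro CollectI exI[of _ "m - 1"]) auto
      qed
    qed
    moreover have "e \<subseteq> set c" if "e \<in> cycle_edges c" for e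
      using that m3 by (auto simp: cycle_edges_def len)
    ultimately have "is_cycle E c" "{e \<in> E. e \<subseteq> set c} = cycle_edges c" "set c \<subseteq> U"
      using m3 len unfolding is_cycle_def by (simp, blast, blast)
    moreover have "odd (length c)"
      using m(1) len by simp
    ultimately show ?thesis
      using cycle unfolding is_induced_cycle_def by metis
  qed
qed

text \<open>
  Each of the edges of the cycle contains a vertex of \<open>W\<close>, and each vertex lies on two of them. In the
  proof, \<open>rotate1 c ! i\<close> is the vertex that follows \<open>c ! i\<close> on the cycle.
\<close>

lemma vertex_cover_cycle_card:
  assumes "is_cycle E c" and "vertex_cover E W"
  shows "length c \<le> 2 * card (W \<inter> set c)"
proof -
  define g where "g x = (of_bool (x \<in> W) :: nat)" for x
  have "1 \<le> g (c ! i) + g (rotate1 c ! i)" if "i < length c" for i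
  proof -
    have "{c ! i, c ! (Suc i mod length c)} \<in> E"
      using assms(1) that unfolding is_cycle_def cycle_edges_def by blast
    then show ?thesis
      using assms(2) nth_rotate1[OF that] by (auto simp: vertex_cover_def g_def)
  qed
  then have "(\<Sum>i<length c. 1) \<le> (\<Sum>i<length c. g (c ! i) + g (rotate1 c ! i))"
    by (intro sum_mono) auto
  also have "\<dots> = (\<Sum>x\<leftarrow>c. g x) + (\<Sum>x\<leftarrow>rotate1 c. g x)"
    by (simp add: sum.distrib sum_list_sum_nth lessThan_atLeast0)
  also have "(\<Sum>x\<leftarrow>rotate1 c. g x) = (\<Sum>x\<leftarrow>c. g x)"
    by (cases c) (auto simp: add.commute)
  also have "(\<Sum>x\<leftarrow>c. g x) = card (W \<inter> set c)"
    using assms(1) by (simp add: is_cycle_def sum_list_distinct_conv_sum_set g_def Int_def conj_commute)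
  finally show ?thesis
    by simp
qed

text \<open>
  The combinatorial core of the inclusion of the intersection in the radical: enough weight on \<open>B\<close>
  makes up for the odd cycles whose closed neighbourhood meets \<open>B\<close>. The induction splits off an
  edge \<open>{x, b}\<close> with \<open>b \<in> B\<close> as long as there is one. The bound on the covers survives: a cover that
  contains \<open>b\<close> is heavy because of \<open>b\<close> alone, and any other cover loses only the unit at \<open>x\<close>.
\<close>

lemma packs_if_meets_short_cycles:
  assumes G: "simple_graph n E"
    and B: "\<And>b. b \<in> B \<Longrightarrow> k \<le> w b"
    and cycles: "\<And>c. c \<in> short_induced_odd_cycles E k \<Longrightarrow>
        (\<exists>e \<in> E. e \<subseteq> B) \<or> closed_neighborhood E (set c) \<inter> B \<noteq> {}"
    and cover: "\<And>W. W \<subseteq> {1..n} \<Longrightarrow> vertex_cover E W \<Longrightarrow> k \<le> sum w W"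
  shows "packs E k w"
  using B cycles cover
proof (induction k arbitrary: w)
  case (Suc k)
  have card2: "card e = 2" and sub: "e \<subseteq> {1..n}" if "e \<in> E" for e
    using G that by (auto simp: simple_graph_def)
  show ?case
  proof (cases "\<exists>x b. {x, b} \<in> E \<and> b \<in> B \<and> 0 < w x")
    case True
    then obtain x b where xb: "{x, b} \<in> E" "b \<in> B" "0 < w x"
      by blast
    let ?e = "{x, b}" and ?w = "\<lambda>y. w y - of_bool (y \<in> {x, b})"
    have pos: "\<forall>y \<in> ?e. 0 < w y"
      using xb Suc.prems(1)[of b] by auto
    have weight: "k \<le> ?w y" if "y \<in> B" for y
      using Suc.prems(1)[OF that] by (cases "y \<in> {x, b}") auto
    have "packs E k ?w"
    proof (rule Suc.IH)
      show "(\<exists>e \<in> E. e \<subseteq> B) \<or> closed_neighborhood E (set c) \<inter> B \<noteq> {}"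
        if "c \<in> short_induced_odd_cycles E k" for c
        using that by (intro Suc.prems(2)) (auto simp: short_induced_odd_cycles_def)
      show "k \<le> sum ?w W" if W: "W \<subseteq> {1..n}" "vertex_cover E W" for W
      proof (cases "b \<in> W")
        case True
        have "?w b \<le> sum ?w W"
          using True finite_subset[OF W(1)] by (intro member_le_sum) auto
        then show ?thesis
          using weight[OF xb(2)] by linarith
      next
        case False
        then have "card (W \<inter> ?e) \<le> card {x}"
          by (intro card_mono) auto
        then show ?thesis
          using Suc.prems(3)[OF W] sum_delete_edge[OF finite_subset[OF W(1)] pos] by simp
      qed
    qed (rule weight)
    then show ?thesis
      using xb(1) pos unfolding packs.simps by blast
  next
    case no_edge: False
    \<comment> \<open>The vertices of positive weight outside the closed neighbourhood of \<open>B\<close>.\<close>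
    define U where "U = {x. 0 < w x \<and> x \<notin> B \<and> (\<forall>b \<in> B. {x, b} \<notin> E)}"
    have B_pos: "0 < w b" if "b \<in> B" for b
      using Suc.prems(1)[OF that] by simp
    have U: "u \<in> U" if "{u, v} \<in> E" "0 < w u" "0 < w v" for u v
      using that no_edge by (auto simp: U_def insert_commute)
    show ?thesis
    proof (rule two_colouring_or_induced_odd_cycle[OF card2])
      fix col :: "nat \<Rightarrow> bool"
      assume col: "\<And>u v. {u, v} \<in> E \<Longrightarrow> u \<in> U \<Longrightarrow> v \<in> U \<Longrightarrow> col u \<noteq> col v"
      show ?thesis
      proof (rule packs_if_bipartite[of "{1..n}" E _ col])
        show "col u \<noteq> col v" if "{u, v} \<in> E" "0 < w u" "0 < w v" for u v
          using that U[of u v] U[of v u] by (intro col) (auto simp: insert_commute)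
      qed (use sub card2 Suc.prems(3) in auto)
    next
      fix c assume c: "is_induced_cycle E c" "odd (length c)" "set c \<subseteq> U"
      have "c \<notin> short_induced_odd_cycles E (Suc k)"
      proof
        assume "c \<in> short_induced_odd_cycles E (Suc k)"
        then consider e where "e \<in> E" "e \<subseteq> B" | b where "b \<in> B" "b \<in> closed_neighborhood E (set c)"
          using Suc.prems(2) by blast
        then show False
        proof cases
          case 1
          obtain x y where "e = {x, y}"
            using card2[OF 1(1)] by (auto simp: card_2_iff)
          then show False
            using 1 no_edge B_pos[of x] by auto
        next
          case 2
          then show False
            using c(3) by (auto simp: closed_neighborhood_def U_def insert_commute)
        qed
      qed
      then have "2 * Suc k \<le> length c"
        using c by (auto simp: short_induced_odd_cycles_def)
      moreover have "{c ! i, c ! Suc i} \<in> E" if "Suc i < length c" for i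
      proof -
        have "{c ! i, c ! (Suc i mod length c)} \<in> cycle_edges c"
          using that unfolding cycle_edges_def by (intro CollectI exI[of _ i]) auto
        then show ?thesis
          using that c(1) by (auto simp: is_induced_cycle_def is_cycle_def)
      qed
      moreover have "\<forall>x \<in> set c. 0 < w x"
        using c(3) by (auto simp: U_def)
      moreover have "distinct c"
        using c(1) by (simp add: is_induced_cycle_def is_cycle_def)
      ultimately show ?thesis
        by (intro packs_path)
    qed
  qed
qed simp

section \<open>Polynomials and their monomials\<close>

lemma polynomial_ring_simps:
  "monoid.mult (polynomial_ring n) = (*)" "one (polynomial_ring n) = 1"
  "ring.zero (polynomial_ring n) = 0" "add (polynomial_ring n) = (+)"
  by (simp_all add: polynomial_ring_def)

lemma in_polynomial_ring_iff:
  "p \<in> carrier (polynomial_ring n) \<longleftrightarrow> (\<forall>m \<in> Poly_Mapping.keys p. Poly_Mapping.keys m \<subseteq> {1..n})"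
  by (simp add: polynomial_ring_def)

lemma polynomial_ring_pow: "p [^]\<^bsub>polynomial_ring n\<^esub> (k :: nat) = p ^ k"
  by (induction k) (simp_all add: polynomial_ring_simps power_Suc2 del: power_Suc)

lemma a_inv_polynomial_ring:
  fixes p :: "('k::field) mpoly"
  assumes "p \<in> carrier (polynomial_ring n)"
  shows "\<ominus>\<^bsub>polynomial_ring n\<^esub> p = - p"
proof -
  interpret cring "polynomial_ring n :: 'k mpoly ring"
    by (rule cring_polynomial_ring)
  have "- p \<in> carrier (polynomial_ring n)"
    using assms by (simp add: in_polynomial_ring_iff in_keys_iff)
  then show ?thesis
    using assms by (intro minus_equality) (simp_all add: polynomial_ring_simps)
qed

lemma keys_add_exponents:
  fixes a b :: "nat \<Rightarrow>\<^sub>0 nat"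
  shows "Poly_Mapping.keys (a + b) = Poly_Mapping.keys a \<union> Poly_Mapping.keys b"
  by (auto simp: in_keys_iff lookup_add)

lemma in_keys_iff_single_divides:
  fixes m :: "nat \<Rightarrow>\<^sub>0 nat"
  shows "i \<in> Poly_Mapping.keys m \<longleftrightarrow> (\<exists>h. m = Poly_Mapping.single i 1 + h)"
proof
  assume "i \<in> Poly_Mapping.keys m"
  then have "m = Poly_Mapping.single i 1 + (m - Poly_Mapping.single i 1)"
    by (intro poly_mapping_eqI) (auto simp: lookup_add lookup_minus lookup_single in_keys_iff when_def)
  then show "\<exists>h. m = Poly_Mapping.single i 1 + h" ..
qed (auto simp: keys_add_exponents)

text \<open>
  Multiplication by a monomial is injective on exponents, so nothing cancels.
\<close>

lemma keys_monomial_mult: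
  fixes p :: "('k::field) mpoly"
  assumes "w \<in> Poly_Mapping.keys p"
  shows "w + a \<in> Poly_Mapping.keys (p * Poly_Mapping.single a 1)"
proof -
  define c where "c = Poly_Mapping.lookup p w"
  define q where "q = p - Poly_Mapping.single w c"
  have p: "p = Poly_Mapping.single w c + q"
    by (simp add: q_def)
  have w: "w \<notin> Poly_Mapping.keys q"
    by (simp add: q_def c_def in_keys_iff lookup_minus)
  have "w + a \<notin> Poly_Mapping.keys (q * Poly_Mapping.single a 1)"
    using keys_mult[of q "Poly_Mapping.single a (1::'k)"] w by auto
  moreover have "p * Poly_Mapping.single a 1 = Poly_Mapping.single (w + a) c + q * Poly_Mapping.single a 1"
    by (simp add: p distrib_right mult_single)
  moreover have "c \<noteq> 0"
    using assms by (simp add: c_def in_keys_iff)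
  ultimately show ?thesis
    by (simp add: in_keys_iff lookup_add)
qed

text \<open>
  A monomial of \<open>f ^ M\<close> is a product of \<open>M\<close> monomials of \<open>f\<close>. If there are more than \<open>k\<close> factors for
  each monomial of \<open>f\<close>, then one of these occurs at least \<open>k\<close> times.
\<close>

lemma keys_power_pigeonhole:
  fixes f :: "('k::field) mpoly"
  assumes "m \<in> Poly_Mapping.keys (f ^ M)" and "card (Poly_Mapping.keys f) * k < M"
  shows "\<exists>u \<in> Poly_Mapping.keys f. \<forall>i. k * Poly_Mapping.lookup u i \<le> Poly_Mapping.lookup m i"
proof -
  \<comment> \<open>\<open>c u\<close> is the number of times that \<open>u\<close> occurs among the factors.\<close>
  have "\<exists>c. sum c (Poly_Mapping.keys f) = M \<and>
      (\<forall>i. Poly_Mapping.lookup m i = (\<Sum>u\<in>Poly_Mapping.keys f. c u * Poly_Mapping.lookup u i))"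
    using assms(1)
  proof (induction M arbitrary: m)
    case 0
    then have "m = 0"
      by simp
    then show ?case
      by (intro exI[of _ "\<lambda>_. 0"]) simp
  next
    case (Suc M)
    then obtain u m' where m: "m = u + m'" "u \<in> Poly_Mapping.keys f" "m' \<in> Poly_Mapping.keys (f ^ M)"
      using keys_mult[of f "f ^ M"] by auto
    obtain c where c: "sum c (Poly_Mapping.keys f) = M"
      "\<And>i. Poly_Mapping.lookup m' i = (\<Sum>u\<in>Poly_Mapping.keys f. c u * Poly_Mapping.lookup u i)"
      using Suc.IH[OF m(3)] by blast
    have "(\<Sum>v\<in>Poly_Mapping.keys f. c v + of_bool (v = u)) = Suc M"
      using m(2) c(1) by (simp add: sum.distrib of_bool_def)
    moreover have "(c v + of_bool (v = u)) * x = c v * x + (if v = u then x else 0)" for v x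
      by simp
    then have "Poly_Mapping.lookup m i =
        (\<Sum>v\<in>Poly_Mapping.keys f. (c v + of_bool (v = u)) * Poly_Mapping.lookup v i)" for i
      using m(2) by (simp add: m(1) c(2) lookup_add sum.distrib del: of_bool_eq)
    ultimately show ?case
      by blast
  qed
  then obtain c where c: "sum c (Poly_Mapping.keys f) = M"
    "\<And>i. Poly_Mapping.lookup m i = (\<Sum>u\<in>Poly_Mapping.keys f. c u * Poly_Mapping.lookup u i)"
    by blast
  have "\<exists>u \<in> Poly_Mapping.keys f. k \<le> c u"
  proof (rule ccontr)
    assume "\<not> ?thesis"
    then have "sum c (Poly_Mapping.keys f) \<le> card (Poly_Mapping.keys f) * k"
      using sum_bounded_above[of "Poly_Mapping.keys f" c k] by (auto simp: not_le less_imp_le)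
    then show False
      using c(1) assms(2) by simp
  qed
  then obtain u where u: "u \<in> Poly_Mapping.keys f" "k \<le> c u"
    by blast
  have "k * Poly_Mapping.lookup u i \<le> Poly_Mapping.lookup m i" for i
  proof -
    have "k * Poly_Mapping.lookup u i \<le> c u * Poly_Mapping.lookup u i"
      using u(2) by simp
    also have "\<dots> \<le> (\<Sum>u\<in>Poly_Mapping.keys f. c u * Poly_Mapping.lookup u i)"
      using u(1) by (intro member_le_sum) auto
    finally show ?thesis
      by (simp add: c(2))
  qed
  then show ?thesis
    using u(1) by blast
qed

section \<open>Ideals spanned by monomials\<close>

definition monomial_span :: "nat \<Rightarrow> (nat \<Rightarrow>\<^sub>0 nat) set \<Rightarrow> ('k::field) mpoly set" where
  "monomial_span n D = {p \<in> carrier (polynomial_ring n). Poly_Mapping.keys p \<subseteq> D}"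

lemma monomial_span_add:
  assumes "p \<in> monomial_span n D" and "q \<in> monomial_span n D"
  shows "p + q \<in> monomial_span n D"
proof -
  have "m \<in> Poly_Mapping.keys p \<or> m \<in> Poly_Mapping.keys q" if "m \<in> Poly_Mapping.keys (p + q)" for m
    using that keys_add[of p q] by blast
  then show ?thesis
    using assms unfolding monomial_span_def in_polynomial_ring_iff by blast
qed

lemma monomial_in_monomial_span:
  assumes "m \<in> D" and "Poly_Mapping.keys m \<subseteq> {1..n}"
  shows "Poly_Mapping.single m c \<in> monomial_span n D"
  using assms by (auto simp: monomial_span_def in_polynomial_ring_iff split: if_splits)

text \<open>
  The induction principle for spans of monomials: a polynomial is the sum of its terms.
\<close>

lemma monomial_span_subset:
  fixes T :: "('k::field) mpoly set"
  assumes "0 \<in> T" and "\<And>p q. p \<in> T \<Longrightarrow> q \<in> T \<Longrightarrow> p + q \<in> T"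
    and "\<And>m c. m \<in> D \<Longrightarrow> Poly_Mapping.keys m \<subseteq> {1..n} \<Longrightarrow> Poly_Mapping.single m c \<in> T"
  shows "monomial_span n D \<subseteq> T"
proof
  fix p :: "'k mpoly" assume p: "p \<in> monomial_span n D"
  have sum_closed: "sum g A \<in> T" if "finite A" "\<And>m. m \<in> A \<Longrightarrow> g m \<in> T" for g and A :: "(nat \<Rightarrow>\<^sub>0 nat) set"
    using that by (induction A rule: finite_induct) (auto intro: assms(1,2))
  then have "(\<Sum>m\<in>Poly_Mapping.keys p. Poly_Mapping.single m (Poly_Mapping.lookup p m)) \<in> T"
    using p by (intro sum_closed finite_keys assms(3)) (auto simp: monomial_span_def in_polynomial_ring_iff)
  also have "(\<Sum>m\<in>Poly_Mapping.keys p. Poly_Mapping.single m (Poly_Mapping.lookup p m)) = p"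
    by (intro poly_mapping_eqI) (simp add: lookup_sum lookup_single when_def in_keys_iff)
  finally show "p \<in> T" .
qed

lemma ideal_monomial_span:
  assumes "\<And>m h. m \<in> D \<Longrightarrow> m + h \<in> D"
  shows "ideal (monomial_span n D :: ('k::field) mpoly set) (polynomial_ring n)"
proof -
  interpret cring "polynomial_ring n :: 'k mpoly ring"
    by (rule cring_polynomial_ring)
  show ?thesis
  proof (rule idealI)
    show "subgroup (monomial_span n D :: 'k mpoly set) (add_monoid (polynomial_ring n))"
    proof (rule add.subgroupI)
      show "monomial_span n D \<subseteq> carrier (polynomial_ring n)"
        by (auto simp: monomial_span_def)
      have "0 \<in> monomial_span n D"
        by (simp add: monomial_span_def in_polynomial_ring_iff)
      then show "monomial_span n D \<noteq> ({} :: 'k mpoly set)"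
        by blast
    next
      fix p :: "'k mpoly" assume "p \<in> monomial_span n D"
      then show "\<ominus>\<^bsub>polynomial_ring n\<^esub> p \<in> monomial_span n D"
        by (auto simp: monomial_span_def a_inv_polynomial_ring in_polynomial_ring_iff in_keys_iff)
    qed (simp add: polynomial_ring_simps monomial_span_add)
  next
    fix p q :: "'k mpoly"
    assume p: "p \<in> monomial_span n D" and q: "q \<in> carrier (polynomial_ring n)"
    have "Poly_Mapping.keys (q * p) \<subseteq> D"
    proof
      fix m assume "m \<in> Poly_Mapping.keys (q * p)"
      then obtain a b where "m = a + b" "b \<in> Poly_Mapping.keys p"
        using keys_mult[of q p] by blast
      then show "m \<in> D"
        using assms[of b a] p by (auto simp: monomial_span_def add.commute)
    qed
    moreover have "q * p \<in> carrier (polynomial_ring n)"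
      using m_closed[OF q, of p] p by (simp add: monomial_span_def polynomial_ring_simps)
    ultimately show "q \<otimes>\<^bsub>polynomial_ring n\<^esub> p \<in> monomial_span n D"
      by (simp add: monomial_span_def polynomial_ring_simps)
    then show "p \<otimes>\<^bsub>polynomial_ring n\<^esub> q \<in> monomial_span n D"
      by (simp add: polynomial_ring_simps mult.commute)
  qed (rule ring_axioms)
qed

text \<open>
  The hypothesis speaks only of exponents supported on \<open>{1..n}\<close>, as all others are excluded by the
  carrier.
\<close>

lemma ideal_prod_monomial_span:
  assumes "\<And>m. Poly_Mapping.keys m \<subseteq> {1..n} \<Longrightarrow> m \<in> D \<longleftrightarrow> (\<exists>a \<in> D1. \<exists>b \<in> D2. m = a + b)"
  shows "ideal_prod (polynomial_ring n) (monomial_span n D1) (monomial_span n D2)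
      = (monomial_span n D :: ('k::field) mpoly set)"
    (is "?prod = _")
proof
  interpret cring "polynomial_ring n :: 'k mpoly ring"
    by (rule cring_polynomial_ring)
  show "?prod \<subseteq> monomial_span n D"
  proof
    fix p assume "p \<in> ?prod"
    then show "p \<in> monomial_span n D"
    proof (induction p rule: ideal_prod.induct)
      case (prod p q)
      then have carr: "p * q \<in> carrier (polynomial_ring n)"
        using m_closed[of p q] by (simp add: monomial_span_def polynomial_ring_simps)
      moreover have "m \<in> D" if m: "m \<in> Poly_Mapping.keys (p * q)" for m
      proof -
        obtain a b where "m = a + b" "a \<in> Poly_Mapping.keys p" "b \<in> Poly_Mapping.keys q"
          using keys_mult[of p q] m by blast
        then have "\<exists>a \<in> D1. \<exists>b \<in> D2. m = a + b"
          using prod by (auto simp: monomial_span_def)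
        then show ?thesis
          using assms[of m] carr m by (simp add: in_polynomial_ring_iff)
      qed
      ultimately show ?case
        by (auto simp: monomial_span_def polynomial_ring_simps)
    qed (simp add: polynomial_ring_simps monomial_span_add)
  qed
  have zero: "0 \<in> monomial_span n D1" "0 \<in> monomial_span n D2"
    by (auto simp: monomial_span_def in_polynomial_ring_iff)
  show "monomial_span n D \<subseteq> ?prod"
  proof (rule monomial_span_subset)
    show "0 \<in> ?prod"
      using ideal_prod.prod[OF zero, of "polynomial_ring n"] by (simp add: polynomial_ring_simps)
    show "p + q \<in> ?prod" if "p \<in> ?prod" "q \<in> ?prod" for p q
      using ideal_prod.sum[OF that] by (simp add: polynomial_ring_simps)
    fix m and c :: 'k
    assume m: "m \<in> D" "Poly_Mapping.keys m \<subseteq> {1..n}"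
    then obtain a b where ab: "a \<in> D1" "b \<in> D2" "m = a + b"
      using assms by blast
    then have "Poly_Mapping.keys a \<subseteq> {1..n}" "Poly_Mapping.keys b \<subseteq> {1..n}"
      using m(2) by (auto simp: keys_add_exponents)
    then have "Poly_Mapping.single a c \<otimes>\<^bsub>polynomial_ring n\<^esub> Poly_Mapping.single b 1 \<in> ?prod"
      using ab by (intro ideal_prod.prod monomial_in_monomial_span)
    then show "Poly_Mapping.single m c \<in> ?prod"
      by (simp add: polynomial_ring_simps mult_single ab(3))
  qed
qed

lemma ideal_power_monomial_span:
  assumes "\<And>k m. Poly_Mapping.keys m \<subseteq> {1..n} \<Longrightarrow>
      m \<in> D (Suc k) \<longleftrightarrow> (\<exists>a \<in> D k. \<exists>b \<in> D1. m = a + b)"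
    and "D 0 = UNIV"
  shows "ideal_power (polynomial_ring n) (monomial_span n D1) k
      = (monomial_span n (D k) :: ('k::field) mpoly set)"
proof (induction k)
  case 0
  then show ?case
    using assms(2) by (simp add: ideals_set_def monomial_span_def)
next
  case (Suc k)
  then show ?case
    using ideal_prod_monomial_span[of n "D (Suc k)" "D k" D1] assms(1) by (simp add: ideals_set_def)
qed

lemma set_add_monomial_span:
  "monomial_span n D1 <+>\<^bsub>polynomial_ring n\<^esub> monomial_span n D2
      = (monomial_span n (D1 \<union> D2) :: ('k::field) mpoly set)"
    (is "?sum = _")
proof
  have sum: "p \<in> ?sum \<longleftrightarrow> (\<exists>q \<in> monomial_span n D1. \<exists>r \<in> monomial_span n D2. p = q + r)" for p
    by (auto simp: set_add_def' polynomial_ring_simps)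
  have mono: "monomial_span n D1 \<subseteq> monomial_span n (D1 \<union> D2)"
    "monomial_span n D2 \<subseteq> monomial_span n (D1 \<union> D2)"
    by (auto simp: monomial_span_def)
  show "?sum \<subseteq> monomial_span n (D1 \<union> D2)"
  proof
    fix p assume "p \<in> ?sum"
    then obtain q r where "q \<in> monomial_span n D1" "r \<in> monomial_span n D2" "p = q + r"
      unfolding sum by blast
    then show "p \<in> monomial_span n (D1 \<union> D2)"
      using mono monomial_span_add[of q n "D1 \<union> D2" r] by blast
  qed
  have zero: "0 \<in> monomial_span n D1" "0 \<in> monomial_span n D2"
    by (auto simp: monomial_span_def in_polynomial_ring_iff)
  show "monomial_span n (D1 \<union> D2) \<subseteq> ?sum"
  proof (rule monomial_span_subset)
    show "0 \<in> ?sum"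
      unfolding sum using zero by (metis add_0)
    show "p + p' \<in> ?sum" if pp: "p \<in> ?sum" "p' \<in> ?sum" for p p'
    proof -
      obtain q r q' r' where qr: "q \<in> monomial_span n D1" "r \<in> monomial_span n D2" "p = q + r"
        "q' \<in> monomial_span n D1" "r' \<in> monomial_span n D2" "p' = q' + r'"
        using pp unfolding sum by blast
      have "p + p' = (q + q') + (r + r')"
        using qr by (simp add: algebra_simps)
      then show ?thesis
        unfolding sum using qr by (blast intro: monomial_span_add)
    qed
    fix m and c :: 'k
    assume m: "m \<in> D1 \<union> D2" "Poly_Mapping.keys m \<subseteq> {1..n}"
    then have "Poly_Mapping.single m c \<in> monomial_span n D1 \<or> Poly_Mapping.single m c \<in> monomial_span n D2"
      by (blast intro: monomial_in_monomial_span)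
    then show "Poly_Mapping.single m c \<in> ?sum"
      unfolding sum using zero by (metis add_0 add_0_right)
  qed
qed

lemma genideal_monomials:
  fixes G :: "(nat \<Rightarrow>\<^sub>0 nat) set"
  assumes "\<And>g. g \<in> G \<Longrightarrow> Poly_Mapping.keys g \<subseteq> {1..n}"
  shows "Idl\<^bsub>polynomial_ring n\<^esub> ((\<lambda>g. Poly_Mapping.single g 1) ` G)
      = (monomial_span n {g + h | g h. g \<in> G} :: ('k::field) mpoly set)"
    (is "?I = monomial_span n ?D")
proof
  interpret cring "polynomial_ring n :: 'k mpoly ring"
    by (rule cring_polynomial_ring)
  let ?M = "(\<lambda>g. Poly_Mapping.single g 1) ` G :: 'k mpoly set"
  have carr: "?M \<subseteq> carrier (polynomial_ring n)"
    using assms by (auto simp: in_polynomial_ring_iff)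
  then interpret I: ideal ?I "polynomial_ring n"
    by (rule genideal_ideal)
  have "ideal (monomial_span n ?D :: 'k mpoly set) (polynomial_ring n)"
  proof (rule ideal_monomial_span)
    fix m h assume "m \<in> ?D"
    then obtain g h' where "g \<in> G" "m = g + h'"
      by blast
    then show "m + h \<in> ?D"
      by (metis (mono_tags, lifting) CollectI add.assoc)
  qed
  moreover have "?M \<subseteq> monomial_span n ?D"
  proof
    fix p assume "p \<in> ?M"
    then obtain g where g: "g \<in> G" "p = Poly_Mapping.single g 1"
      by blast
    have "g \<in> ?D"
      using g(1) by (metis (mono_tags, lifting) CollectI add_0_right)
    then show "p \<in> monomial_span n ?D"
      unfolding g(2) using assms[OF g(1)] by (rule monomial_in_monomial_span)
  qed
  ultimately show "?I \<subseteq> monomial_span n ?D"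
    by (rule genideal_minimal)
  show "monomial_span n ?D \<subseteq> ?I"
  proof (rule monomial_span_subset)
    show "0 \<in> ?I"
      using I.zero_closed by (simp add: polynomial_ring_simps)
    show "p + q \<in> ?I" if "p \<in> ?I" "q \<in> ?I" for p q
      using I.a_closed[OF that] by (simp add: polynomial_ring_simps)
    fix m and c :: 'k
    assume m: "m \<in> ?D" "Poly_Mapping.keys m \<subseteq> {1..n}"
    then obtain g h where gh: "m = g + h" "g \<in> G"
      by blast
    have "Poly_Mapping.single g 1 \<in> ?I"
      using genideal_self[OF carr] gh(2) by blast
    moreover have "Poly_Mapping.single h c \<in> carrier (polynomial_ring n)"
      using m(2) by (auto simp: gh(1) keys_add_exponents in_polynomial_ring_iff split: if_splits)
    ultimately have "Poly_Mapping.single g 1 \<otimes>\<^bsub>polynomial_ring n\<^esub> Poly_Mapping.single h c \<in> ?I"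
      by (rule I.I_r_closed)
    then show "Poly_Mapping.single m c \<in> ?I"
      by (simp add: polynomial_ring_simps mult_single gh(1))
  qed
qed

text \<open>
  Since an edge has two distinct end points, \<open>x\<^sub>i x\<^sub>j\<close> divides a monomial iff both end points lie in
  its support.
\<close>

lemma edge_ideal_eq:
  assumes "simple_graph n E"
  shows "edge_ideal n E
      = (monomial_span n {m. \<exists>e \<in> E. e \<subseteq> Poly_Mapping.keys m} :: ('k::field) mpoly set)"
proof -
  define x where "x i = Poly_Mapping.single i (1::nat)" for i :: nat
  define G where "G = {x i + x j | i j. {i, j} \<in> E}"
  have E: "{i, j} \<subseteq> {1..n}" "i \<noteq> j" if "{i, j} \<in> E" for i j
    using assms that unfolding simple_graph_def by fastforce+
  have edge: "(\<exists>h. m = x i + x j + h) \<longleftrightarrow> {i, j} \<subseteq> Poly_Mapping.keys m" if "i \<noteq> j" for m i j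
  proof
    assume "{i, j} \<subseteq> Poly_Mapping.keys m"
    then obtain h where h: "m = x i + h"
      using in_keys_iff_single_divides[of i m] unfolding x_def by auto
    then have "j \<in> Poly_Mapping.keys h"
      using \<open>{i, j} \<subseteq> Poly_Mapping.keys m\<close> that by (auto simp: keys_add_exponents x_def)
    then obtain h' where "h = x j + h'"
      using in_keys_iff_single_divides[of j h] unfolding x_def by auto
    then show "\<exists>h. m = x i + x j + h"
      using h by (metis add.assoc)
  qed (auto simp: keys_add_exponents x_def)
  have "{pvar i * pvar j | i j. {i, j} \<in> E} = (\<lambda>g. Poly_Mapping.single g (1::'k)) ` G"
    by (auto simp: G_def pvar_def mult_single x_def)
  then have "edge_ideal n E = Idl\<^bsub>polynomial_ring n\<^esub> ((\<lambda>g. Poly_Mapping.single g (1::'k)) ` G)"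
    by (simp add: edge_ideal_def)
  also have "\<dots> = monomial_span n {g + h | g h. g \<in> G}"
    using E by (intro genideal_monomials) (auto simp: G_def keys_add_exponents x_def)
  also have "{g + h | g h. g \<in> G} = {m. \<exists>e \<in> E. e \<subseteq> Poly_Mapping.keys m}"
  proof (intro equalityI subsetI)
    fix m assume "m \<in> {g + h | g h. g \<in> G}"
    then obtain i j h where "{i, j} \<in> E" "m = x i + x j + h"
      unfolding G_def by blast
    then show "m \<in> {m. \<exists>e \<in> E. e \<subseteq> Poly_Mapping.keys m}"
      using edge[OF E(2), of i j m] by blast
  next
    fix m :: "nat \<Rightarrow>\<^sub>0 nat" assume "m \<in> {m. \<exists>e \<in> E. e \<subseteq> Poly_Mapping.keys m}"
    then obtain e where e: "e \<in> E" "e \<subseteq> Poly_Mapping.keys m"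
      by blast
    then obtain i j where ij: "e = {i, j}" "i \<noteq> j"
      using assms by (auto simp: simple_graph_def card_2_iff)
    then obtain h where "m = x i + x j + h"
      using edge[OF ij(2), of m] e(2) ij(1) by auto
    moreover have "x i + x j \<in> G"
      using e(1) ij(1) unfolding G_def by blast
    ultimately show "m \<in> {g + h | g h. g \<in> G}"
      by blast
  qed
  finally show ?thesis .
qed

section \<open>Ideals generated by variables\<close>

definition variable_ideal :: "nat \<Rightarrow> nat set \<Rightarrow> ('k::field) mpoly set" where
  "variable_ideal n A = monomial_span n {m. Poly_Mapping.keys m \<inter> A \<noteq> {}}"

lemma genideal_variables:
  assumes "A \<subseteq> {1..n}"
  shows "Idl\<^bsub>polynomial_ring n\<^esub> (pvar ` A) = (variable_ideal n A :: ('k::field) mpoly set)"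
proof -
  let ?G = "(\<lambda>i. Poly_Mapping.single i (1::nat)) ` A"
  have "pvar ` A = (\<lambda>g. Poly_Mapping.single g (1::'k)) ` ?G"
    by (simp add: image_image pvar_def)
  moreover have "{g + h | g h. g \<in> ?G} = {m. Poly_Mapping.keys m \<inter> A \<noteq> {}}"
    using in_keys_iff_single_divides by blast
  moreover have "Idl\<^bsub>polynomial_ring n\<^esub> ((\<lambda>g. Poly_Mapping.single g (1::'k)) ` ?G)
      = monomial_span n {g + h | g h. g \<in> ?G}"
    using assms by (intro genideal_monomials) auto
  ultimately show ?thesis
    by (simp only: variable_ideal_def)
qed

text \<open>
  The reason why ideals generated by variables are prime: modulo terms that involve a variable of
  \<open>A\<close>, the product \<open>p * q\<close> agrees with \<open>cut p * cut q\<close>, where \<open>cut\<close> deletes such terms. The latter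
  product has no such terms, and it is nonzero as polynomials have no zero divisors.
\<close>

lemma keys_meet_prime:
  fixes p q :: "('k::field) mpoly"
  assumes pq: "\<And>m. m \<in> Poly_Mapping.keys (p * q) \<Longrightarrow> Poly_Mapping.keys m \<inter> A \<noteq> {}"
    and p: "a \<in> Poly_Mapping.keys p" "Poly_Mapping.keys a \<inter> A = {}"
    and q: "b \<in> Poly_Mapping.keys q" "Poly_Mapping.keys b \<inter> A = {}"
  shows False
proof -
  define cut :: "'k mpoly \<Rightarrow> 'k mpoly"
    where "cut f = Poly_Mapping.mapp (\<lambda>m c. c when Poly_Mapping.keys m \<inter> A = {}) f" for f
  have cut: "Poly_Mapping.lookup (cut f) m
      = (if Poly_Mapping.keys m \<inter> A = {} then Poly_Mapping.lookup f m else 0)" for f m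
    by (auto simp: cut_def lookup_mapp when_def in_keys_iff)
  define p1 q1 where "p1 = p - cut p" and "q1 = q - cut q"
  have meet1: "Poly_Mapping.keys m \<inter> A \<noteq> {}"
    if "m \<in> Poly_Mapping.keys p1 \<or> m \<in> Poly_Mapping.keys q1" for m
    using that by (auto simp: p1_def q1_def in_keys_iff lookup_minus cut)
  have "cut p * cut q = p * q - (p1 * q + cut p * q1)"
    by (simp add: p1_def q1_def algebra_simps)
  moreover have "Poly_Mapping.keys m \<inter> A \<noteq> {}"
    if m: "m \<in> Poly_Mapping.keys (p * q - (p1 * q + cut p * q1))" for m
  proof -
    have "m \<in> Poly_Mapping.keys (p * q) \<or> m \<in> Poly_Mapping.keys (p1 * q) \<or> m \<in> Poly_Mapping.keys (cut p * q1)"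
      using m by (auto simp: in_keys_iff lookup_minus lookup_add)
    moreover have "Poly_Mapping.keys m \<inter> A \<noteq> {}" if "m \<in> Poly_Mapping.keys (p1 * q)"
    proof -
      obtain c d where "m = c + d" "c \<in> Poly_Mapping.keys p1"
        using \<open>m \<in> Poly_Mapping.keys (p1 * q)\<close> keys_mult[of p1 q] by blast
      then show ?thesis
        using meet1[of c] by (auto simp: keys_add_exponents)
    qed
    moreover have "Poly_Mapping.keys m \<inter> A \<noteq> {}" if "m \<in> Poly_Mapping.keys (cut p * q1)"
    proof -
      obtain c d where "m = c + d" "d \<in> Poly_Mapping.keys q1"
        using \<open>m \<in> Poly_Mapping.keys (cut p * q1)\<close> keys_mult[of "cut p" q1] by blast
      then show ?thesis
        using meet1[of d] by (auto simp: keys_add_exponents)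
    qed
    ultimately show ?thesis
      using pq by blast
  qed
  moreover have "Poly_Mapping.keys m \<inter> A = {}" if m: "m \<in> Poly_Mapping.keys (cut p * cut q)" for m
  proof -
    obtain c d where "m = c + d" "c \<in> Poly_Mapping.keys (cut p)" "d \<in> Poly_Mapping.keys (cut q)"
      using m keys_mult[of "cut p" "cut q"] by blast
    then show ?thesis
      by (auto simp: keys_add_exponents in_keys_iff cut split: if_splits)
  qed
  ultimately have "Poly_Mapping.keys (cut p * cut q) = {}"
    by (metis equals0I)
  then have "cut p = 0 \<or> cut q = 0"
    by simp
  moreover have "a \<in> Poly_Mapping.keys (cut p)" "b \<in> Poly_Mapping.keys (cut q)"
    using p q by (simp_all add: in_keys_iff cut)
  ultimately show False
    by auto
qed

text \<open>
  Membership of a power of \<open>f\<close> in the prime ideal generated by the variables in \<open>A\<close> would force \<open>f\<close>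
  itself into that ideal.
\<close>

lemma keys_avoiding_power:
  fixes f :: "('k::field) mpoly"
  assumes "u \<in> Poly_Mapping.keys f" and "Poly_Mapping.keys u \<inter> A = {}"
  obtains w where "w \<in> Poly_Mapping.keys (f ^ M)" and "Poly_Mapping.keys w \<inter> A = {}"
proof -
  have "\<exists>w \<in> Poly_Mapping.keys (f ^ M). Poly_Mapping.keys w \<inter> A = {}"
  proof (induction M)
    case (Suc M)
    then show ?case
      using keys_meet_prime[of f "f ^ M" A] assms unfolding power_Suc by blast
  qed simp
  then show ?thesis
    using that by blast
qed

lemma primeideal_variable_ideal:
  "primeideal (variable_ideal n A :: ('k::field) mpoly set) (polynomial_ring n)"
proof (rule primeidealI)
  show "ideal (variable_ideal n A :: 'k mpoly set) (polynomial_ring n)"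
    unfolding variable_ideal_def by (rule ideal_monomial_span) (auto simp: keys_add_exponents)
  have "1 \<in> carrier (polynomial_ring n)" "(1 :: 'k mpoly) \<notin> variable_ideal n A"
    by (auto simp: variable_ideal_def monomial_span_def in_polynomial_ring_iff)
  then show "carrier (polynomial_ring n) \<noteq> (variable_ideal n A :: 'k mpoly set)"
    by blast
  show "p \<in> variable_ideal n A \<or> q \<in> variable_ideal n A"
    if "p \<in> carrier (polynomial_ring n)" "q \<in> carrier (polynomial_ring n)"
      "p \<otimes>\<^bsub>polynomial_ring n\<^esub> q \<in> variable_ideal n A" for p q :: "'k mpoly"
  proof (rule ccontr)
    assume "\<not> ?thesis"
    with that(1,2) obtain a b where "a \<in> Poly_Mapping.keys p" "Poly_Mapping.keys a \<inter> A = {}"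
      "b \<in> Poly_Mapping.keys q" "Poly_Mapping.keys b \<inter> A = {}"
      by (auto simp: variable_ideal_def monomial_span_def)
    moreover have "Poly_Mapping.keys m \<inter> A \<noteq> {}" if "m \<in> Poly_Mapping.keys (p * q)" for m
      using that \<open>p \<otimes>\<^bsub>polynomial_ring n\<^esub> q \<in> variable_ideal n A\<close>
      by (auto simp: variable_ideal_def monomial_span_def polynomial_ring_simps)
    ultimately show False
      using keys_meet_prime[of p q A] by blast
  qed
qed (rule cring_polynomial_ring)

lemma power_variable_ideal:
  assumes "finite A"
  shows "ideal_power (polynomial_ring n) (variable_ideal n A) k
      = (monomial_span n {m. k \<le> sum (Poly_Mapping.lookup m) A} :: ('k::field) mpoly set)"
  unfolding variable_ideal_def
proof (rule ideal_power_monomial_span)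
  fix k and m :: "nat \<Rightarrow>\<^sub>0 nat"
  show "m \<in> {m. Suc k \<le> sum (Poly_Mapping.lookup m) A} \<longleftrightarrow>
      (\<exists>a \<in> {m. k \<le> sum (Poly_Mapping.lookup m) A}. \<exists>b \<in> {m. Poly_Mapping.keys m \<inter> A \<noteq> {}}. m = a + b)"
  proof
    assume m: "m \<in> {m. Suc k \<le> sum (Poly_Mapping.lookup m) A}"
    then have "sum (Poly_Mapping.lookup m) A \<noteq> 0"
      by auto
    then obtain i where i: "i \<in> A" "i \<in> Poly_Mapping.keys m"
      using assms by (auto simp: in_keys_iff)
    then obtain h where h: "m = Poly_Mapping.single i 1 + h"
      using in_keys_iff_single_divides by blast
    have "sum (Poly_Mapping.lookup m) A = Suc (sum (Poly_Mapping.lookup h) A)"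
      using i(1) assms by (simp add: h lookup_add lookup_single sum.distrib when_def)
    then show "\<exists>a \<in> {m. k \<le> sum (Poly_Mapping.lookup m) A}. \<exists>b \<in> {m. Poly_Mapping.keys m \<inter> A \<noteq> {}}. m = a + b"
      using m i h by (intro bexI[of _ h] bexI[of _ "Poly_Mapping.single i 1"]) (auto simp: add.commute)
  next
    assume "\<exists>a \<in> {m. k \<le> sum (Poly_Mapping.lookup m) A}. \<exists>b \<in> {m. Poly_Mapping.keys m \<inter> A \<noteq> {}}. m = a + b"
    then obtain a b i where ab: "k \<le> sum (Poly_Mapping.lookup a) A" "m = a + b"
      "i \<in> A" "i \<in> Poly_Mapping.keys b"
      by blast
    have "Poly_Mapping.lookup b i \<le> sum (Poly_Mapping.lookup b) A"
      using ab(3) assms by (intro member_le_sum) auto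
    moreover have "0 < Poly_Mapping.lookup b i"
      using ab(4) by (simp add: in_keys_iff)
    ultimately show "m \<in> {m. Suc k \<le> sum (Poly_Mapping.lookup m) A}"
      using ab(1) by (simp add: ab(2) lookup_add sum.distrib)
  qed
qed simp

section \<open>Ordinary and symbolic powers of edge ideals\<close>

text \<open>
  Splitting a monomial of \<open>I\<^bsup>Suc k\<^esup>\<close> into a monomial of \<open>I\<^bsup>k\<^esup>\<close> and one of \<open>I\<close> amounts to
  splitting off one edge from the packing.
\<close>

lemma power_edge_ideal:
  assumes "simple_graph n E"
  shows "ideal_power (polynomial_ring n) (edge_ideal n E) k
      = (monomial_span n {m. packs E k (Poly_Mapping.lookup m)} :: ('k::field) mpoly set)"
  unfolding edge_ideal_eq[OF assms]
proof (rule ideal_power_monomial_span)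
  fix k and m :: "nat \<Rightarrow>\<^sub>0 nat"
  show "m \<in> {m. packs E (Suc k) (Poly_Mapping.lookup m)} \<longleftrightarrow>
      (\<exists>a \<in> {m. packs E k (Poly_Mapping.lookup m)}. \<exists>b \<in> {m. \<exists>e \<in> E. e \<subseteq> Poly_Mapping.keys m}. m = a + b)"
  proof
    assume "m \<in> {m. packs E (Suc k) (Poly_Mapping.lookup m)}"
    then obtain e where e: "e \<in> E" "\<forall>x \<in> e. 0 < Poly_Mapping.lookup m x"
      "packs E k (\<lambda>x. Poly_Mapping.lookup m x - of_bool (x \<in> e))"
      by auto
    have "finite e"
      using assms e(1) by (auto simp: simple_graph_def intro: card_ge_0_finite)
    define b :: "nat \<Rightarrow>\<^sub>0 nat" where "b = (\<Sum>i\<in>e. Poly_Mapping.single i 1)"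
    have b: "Poly_Mapping.lookup b x = of_bool (x \<in> e)" for x
      using \<open>finite e\<close> by (simp add: b_def lookup_sum lookup_single when_def of_bool_def)
    have "m = (m - b) + b"
      using e(2) by (intro poly_mapping_eqI) (auto simp: lookup_add lookup_minus b Suc_leI)
    moreover have "packs E k (Poly_Mapping.lookup (m - b))"
    proof -
      have "Poly_Mapping.lookup (m - b) = (\<lambda>x. Poly_Mapping.lookup m x - of_bool (x \<in> e))"
        by (simp add: fun_eq_iff lookup_minus b)
      then show ?thesis
        using e(3) by simp
    qed
    moreover have "e \<subseteq> Poly_Mapping.keys b"
      by (auto simp: in_keys_iff b)
    ultimately show "\<exists>a \<in> {m. packs E k (Poly_Mapping.lookup m)}.
        \<exists>b \<in> {m. \<exists>e \<in> E. e \<subseteq> Poly_Mapping.keys m}. m = a + b"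
      using e(1) by blast
  next
    assume "\<exists>a \<in> {m. packs E k (Poly_Mapping.lookup m)}.
        \<exists>b \<in> {m. \<exists>e \<in> E. e \<subseteq> Poly_Mapping.keys m}. m = a + b"
    then obtain a b e where ab: "packs E k (Poly_Mapping.lookup a)" "m = a + b"
      "e \<in> E" "e \<subseteq> Poly_Mapping.keys b"
      by blast
    have pos: "0 < Poly_Mapping.lookup b x" if "x \<in> e" for x
      using ab(4) that by (auto simp: in_keys_iff)
    have "packs E k (\<lambda>x. Poly_Mapping.lookup m x - of_bool (x \<in> e))"
      using ab(1)
    proof (rule packs_mono)
      show "Poly_Mapping.lookup a x \<le> Poly_Mapping.lookup m x - of_bool (x \<in> e)" for x
        using pos[of x] by (cases "x \<in> e") (auto simp: ab(2) lookup_add)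
    qed
    moreover have "\<forall>x \<in> e. 0 < Poly_Mapping.lookup m x"
      using pos by (simp add: ab(2) lookup_add)
    ultimately show "m \<in> {m. packs E (Suc k) (Poly_Mapping.lookup m)}"
      using ab(3) unfolding mem_Collect_eq packs.simps by blast
  qed
qed simp

text \<open>
  This shows that the minimal primes of the edge ideal are generated by variables: the variables in
  a prime \<open>Q\<close> above the edge ideal form a cover, as \<open>Q\<close> contains one factor of each generator.
\<close>

lemma primeideal_contains_variable_ideal:
  fixes Q :: "('k::field) mpoly set"
  assumes G: "simple_graph n E"
    and Q: "primeideal Q (polynomial_ring n)" "edge_ideal n E \<subseteq> Q"
  defines "W \<equiv> {i \<in> {1..n}. pvar i \<in> Q}"
  shows "vertex_cover E W" and "variable_ideal n W \<subseteq> Q"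
proof -
  interpret cring "polynomial_ring n :: 'k mpoly ring"
    by (rule cring_polynomial_ring)
  interpret Q: primeideal Q "polynomial_ring n"
    by (rule Q(1))
  show "vertex_cover E W"
    unfolding vertex_cover_def
  proof
    fix e assume e: "e \<in> E"
    then obtain i j where ij: "e = {i, j}" "i \<noteq> j" "{i, j} \<subseteq> {1..n}"
      using G by (auto simp: simple_graph_def card_2_iff)
    have carr: "(pvar i :: 'k mpoly) \<in> carrier (polynomial_ring n)"
      "(pvar j :: 'k mpoly) \<in> carrier (polynomial_ring n)"
      using ij(3) by (auto intro: pvar_in_polynomial_ring)
    have "e \<subseteq> Poly_Mapping.keys (Poly_Mapping.single i (1::nat) + Poly_Mapping.single j 1)"
      by (simp add: ij(1) keys_add_exponents)
    then have "Poly_Mapping.single (Poly_Mapping.single i 1 + Poly_Mapping.single j 1) 1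
        \<in> (edge_ideal n E :: 'k mpoly set)"
      unfolding edge_ideal_eq[OF G] using e ij(3)
      by (intro monomial_in_monomial_span) (auto simp: keys_add_exponents)
    then have "pvar i \<otimes>\<^bsub>polynomial_ring n\<^esub> pvar j \<in> Q"
      using Q(2) by (auto simp: pvar_def polynomial_ring_simps mult_single)
    then have "pvar i \<in> Q \<or> pvar j \<in> Q"
      using Q.I_prime carr by blast
    then show "e \<inter> W \<noteq> {}"
      using ij by (auto simp: W_def)
  qed
  show "variable_ideal n W \<subseteq> Q"
    unfolding variable_ideal_def
  proof (rule monomial_span_subset)
    show "0 \<in> Q"
      using Q.zero_closed by (simp add: polynomial_ring_simps)
    show "p + q \<in> Q" if "p \<in> Q" "q \<in> Q" for p q
      using Q.a_closed[OF that] by (simp add: polynomial_ring_simps)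
    fix m :: "nat \<Rightarrow>\<^sub>0 nat" and c :: 'k
    assume m: "m \<in> {m. Poly_Mapping.keys m \<inter> W \<noteq> {}}" "Poly_Mapping.keys m \<subseteq> {1..n}"
    then obtain i where i: "i \<in> Poly_Mapping.keys m" "pvar i \<in> Q"
      by (auto simp: W_def)
    then obtain h where h: "m = Poly_Mapping.single i 1 + h"
      using in_keys_iff_single_divides by blast
    have "Poly_Mapping.single h c \<in> carrier (polynomial_ring n)"
      using m(2) by (auto simp: h keys_add_exponents in_polynomial_ring_iff split: if_splits)
    then have "pvar i \<otimes>\<^bsub>polynomial_ring n\<^esub> Poly_Mapping.single h c \<in> Q"
      by (rule Q.I_r_closed[OF i(2)])
    then show "Poly_Mapping.single m c \<in> Q"
      by (simp add: pvar_def polynomial_ring_simps mult_single h)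
  qed
qed

lemma variable_ideal_subset_iff:
  assumes "A \<subseteq> {1..n}"
  shows "(variable_ideal n A :: ('k::field) mpoly set) \<subseteq> variable_ideal n B \<longleftrightarrow> A \<subseteq> B"
proof
  assume sub: "(variable_ideal n A :: 'k mpoly set) \<subseteq> variable_ideal n B"
  show "A \<subseteq> B"
  proof
    fix i assume "i \<in> A"
    then have "Poly_Mapping.single (Poly_Mapping.single i 1) (1::'k) \<in> variable_ideal n A"
      unfolding variable_ideal_def using assms by (intro monomial_in_monomial_span) auto
    then show "i \<in> B"
      using sub by (auto simp: variable_ideal_def monomial_span_def)
  qed
qed (auto simp: variable_ideal_def monomial_span_def)

lemma edge_ideal_subset_variable_ideal:
  assumes "simple_graph n E" and "vertex_cover E W"
  shows "edge_ideal n E \<subseteq> (variable_ideal n W :: ('k::field) mpoly set)"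
proof -
  have "Poly_Mapping.keys m \<inter> W \<noteq> {}" if "\<exists>e \<in> E. e \<subseteq> Poly_Mapping.keys m" for m :: "nat \<Rightarrow>\<^sub>0 nat"
    using that assms(2) unfolding vertex_cover_def by blast
  then show ?thesis
    unfolding edge_ideal_eq[OF assms(1)] variable_ideal_def monomial_span_def by blast
qed

text \<open>
  The minimal primes are the ideals of the minimal vertex covers, and the \<open>k\<close>-th power of such an
  ideal consists of the polynomials whose terms have degree at least \<open>k\<close> in the variables of the cover. A
  condition on the minimal covers is inherited by all covers, since these are only heavier.
\<close>

lemma symbolic_power_edge_ideal:
  assumes G: "simple_graph n E"
  shows "symbolic_power (polynomial_ring n) (edge_ideal n E) k
      = (monomial_span n {m. \<forall>W \<subseteq> {1..n}. vertex_cover E W \<longrightarrow> k \<le> sum (Poly_Mapping.lookup m) W}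
          :: ('k::field) mpoly set)"
proof -
  let ?R = "polynomial_ring n :: 'k mpoly ring" and ?I = "edge_ideal n E :: 'k mpoly set"
  have minimal_prime: "\<exists>W \<subseteq> {1..n}. vertex_cover E W \<and> P = variable_ideal n W"
    if "P \<in> minimal_primes ?R ?I" for P
  proof -
    define W where "W = {i \<in> {1..n}. pvar i \<in> P}"
    have P: "primeideal P ?R" "?I \<subseteq> P"
      "\<And>Q. primeideal Q ?R \<Longrightarrow> ?I \<subseteq> Q \<Longrightarrow> Q \<subseteq> P \<Longrightarrow> Q = P"
      using that unfolding minimal_primes_def by blast+
    have "vertex_cover E W" "variable_ideal n W \<subseteq> P"
      using primeideal_contains_variable_ideal[OF G P(1,2)] unfolding W_def by blast+
    moreover from this have "variable_ideal n W = P"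
      using P(3) primeideal_variable_ideal edge_ideal_subset_variable_ideal[OF G] by blast
    moreover have "W \<subseteq> {1..n}"
      by (auto simp: W_def)
    ultimately show ?thesis
      by blast
  qed
  have minimal_cover: "\<exists>W' \<subseteq> W. variable_ideal n W' \<in> minimal_primes ?R ?I"
    if W: "W \<subseteq> {1..n}" "vertex_cover E W" for W
  proof -
    let ?C = "{W. W \<subseteq> {1..n} \<and> vertex_cover E W}"
    have "finite ?C"
      by (rule finite_subset[of _ "Pow {1..n}"]) auto
    moreover have "W \<in> ?C"
      using W by simp
    ultimately obtain W' where "W' \<in> ?C" and W'_sub: "W' \<subseteq> W"
      and least: "\<And>A. A \<in> ?C \<Longrightarrow> A \<subseteq> W' \<Longrightarrow> A = W'"
      using finite_has_minimal2[of ?C W] by metis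
    then have W': "W' \<subseteq> {1..n}" "vertex_cover E W'"
      by simp_all
    have "Q = variable_ideal n W'"
      if Q: "primeideal Q ?R" "?I \<subseteq> Q" "Q \<subseteq> variable_ideal n W'" for Q
    proof -
      define A where "A = {i \<in> {1..n}. pvar i \<in> Q}"
      have A: "vertex_cover E A" "variable_ideal n A \<subseteq> Q" "A \<subseteq> {1..n}"
        using primeideal_contains_variable_ideal[OF G Q(1,2)] unfolding A_def by blast+
      then have "A \<subseteq> W'"
        using Q(3) variable_ideal_subset_iff[OF A(3), where 'k = 'k] by blast
      then show ?thesis
        using least[of A] A Q(3) by blast
    qed
    then have "variable_ideal n W' \<in> minimal_primes ?R ?I"
      using primeideal_variable_ideal edge_ideal_subset_variable_ideal[OF G W'(2)]
      unfolding minimal_primes_def by blast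
    then show ?thesis
      using W'_sub by blast
  qed
  show ?thesis
  proof (intro equalityI subsetI)
    fix p assume p: "p \<in> symbolic_power ?R ?I k"
    have "k \<le> sum (Poly_Mapping.lookup m) W"
      if m: "m \<in> Poly_Mapping.keys p" and W: "W \<subseteq> {1..n}" "vertex_cover E W" for m W
    proof -
      obtain W' where W': "W' \<subseteq> W" "variable_ideal n W' \<in> minimal_primes ?R ?I"
        using minimal_cover[OF W] by blast
      have fin: "finite W" "finite W'"
        using W(1) W'(1) by (meson finite_atLeastAtMost finite_subset)+
      have "p \<in> ideal_power ?R (variable_ideal n W') k"
        using p W'(2) by (auto simp: symbolic_power_def)
      then have "k \<le> sum (Poly_Mapping.lookup m) W'"
        using m by (auto simp: power_variable_ideal[OF fin(2)] monomial_span_def)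
      also have "\<dots> \<le> sum (Poly_Mapping.lookup m) W"
        using fin W'(1) by (intro sum_mono2) auto
      finally show ?thesis .
    qed
    then show "p \<in> monomial_span n {m. \<forall>W \<subseteq> {1..n}. vertex_cover E W \<longrightarrow> k \<le> sum (Poly_Mapping.lookup m) W}"
      using p by (auto simp: monomial_span_def symbolic_power_def)
  next
    fix p :: "'k mpoly"
    assume p: "p \<in> monomial_span n {m. \<forall>W \<subseteq> {1..n}. vertex_cover E W \<longrightarrow> k \<le> sum (Poly_Mapping.lookup m) W}"
    have "p \<in> ideal_power ?R P k" if P: "P \<in> minimal_primes ?R ?I" for P
    proof -
      obtain W where W: "W \<subseteq> {1..n}" "vertex_cover E W" "P = variable_ideal n W"
        using minimal_prime[OF P] by blast
      have "finite W"
        using W(1) by (rule finite_subset) simp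
      then show ?thesis
        using p W by (auto simp: W(3) power_variable_ideal monomial_span_def)
    qed
    then show "p \<in> symbolic_power ?R ?I k"
      using p by (auto simp: symbolic_power_def monomial_span_def)
  qed
qed

section \<open>The annihilator of a quotient of ideals\<close>

text \<open>
  The class of \<open>g\<close> is killed by \<open>r\<close> iff \<open>r \<otimes> g\<close> lies in \<open>N\<close>. The work lies in unfolding the scalar
  multiplication, which is a union of cosets over all representatives \<open>h \<oplus> g\<close>.
\<close>

lemma annihilator_quotient_eq_colon_ideal:
  fixes R (structure)
  assumes "cring R" and "ideal N R" and "J \<subseteq> carrier R"
  shows "annihilator R (quotient_module (ideal_module R J) N) = colon_ideal R N J"
proof -
  interpret cring R by fact
  interpret N: ideal N R by fact
  have coset: "N +>\<^bsub>ideal_module R J\<^esub> x = (\<lambda>h. h \<oplus> x) ` N" for x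
    by (auto simp: a_r_coset_def' ideal_module_def)
  have "carrier (ideal_module R J) = J"
    by (simp add: ideal_module_def)
  then have carr: "carrier (quotient_module (ideal_module R J) N) = (\<lambda>g. (\<lambda>h. h \<oplus> g) ` N) ` J"
    by (auto simp: quotient_module_def A_RCOSETS_def' coset)
  have scale: "r \<odot>\<^bsub>quotient_module (ideal_module R J) N\<^esub> ((\<lambda>h. h \<oplus> g) ` N)
      = (\<Union>h \<in> N. (\<lambda>h'. h' \<oplus> r \<otimes> (h \<oplus> g)) ` N)" for r g
    by (simp add: quotient_module_def coset) (simp add: ideal_module_def)
  have iff: "(\<Union>h \<in> N. (\<lambda>h'. h' \<oplus> r \<otimes> (h \<oplus> g)) ` N) = N \<longleftrightarrow> r \<otimes> g \<in> N"
    if r: "r \<in> carrier R" and g: "g \<in> carrier R" for r g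
  proof
    assume eq: "(\<Union>h \<in> N. (\<lambda>h'. h' \<oplus> r \<otimes> (h \<oplus> g)) ` N) = N"
    have "\<zero> \<oplus> r \<otimes> (\<zero> \<oplus> g) \<in> (\<Union>h \<in> N. (\<lambda>h'. h' \<oplus> r \<otimes> (h \<oplus> g)) ` N)"
      using N.zero_closed by blast
    then show "r \<otimes> g \<in> N"
      using r g unfolding eq by simp
  next
    assume rg: "r \<otimes> g \<in> N"
    show "(\<Union>h \<in> N. (\<lambda>h'. h' \<oplus> r \<otimes> (h \<oplus> g)) ` N) = N"
    proof (intro equalityI subsetI)
      fix y assume "y \<in> (\<Union>h \<in> N. (\<lambda>h'. h' \<oplus> r \<otimes> (h \<oplus> g)) ` N)"
      then obtain h h' where h: "h \<in> N" "h' \<in> N" "y = h' \<oplus> r \<otimes> (h \<oplus> g)"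
        by blast
      have "r \<otimes> (h \<oplus> g) = r \<otimes> h \<oplus> r \<otimes> g"
        using r g h(1) N.Icarr by (simp add: r_distr)
      then show "y \<in> N"
        using h rg r by (simp add: N.I_l_closed N.a_closed)
    next
      fix y assume y: "y \<in> N"
      have "(y \<ominus> r \<otimes> g) \<oplus> r \<otimes> (\<zero> \<oplus> g) = y"
        using y r g N.Icarr by (simp add: minus_eq a_assoc l_neg)
      moreover have "y \<ominus> r \<otimes> g \<in> N"
        using y rg by (simp add: minus_eq N.a_closed N.a_inv_closed)
      ultimately show "y \<in> (\<Union>h \<in> N. (\<lambda>h'. h' \<oplus> r \<otimes> (h \<oplus> g)) ` N)"
        using N.zero_closed by (metis UN_I imageI)
    qed
  qed
  have zero: "\<zero>\<^bsub>quotient_module (ideal_module R J) N\<^esub> = N"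
    by (simp add: quotient_module_def)
  have "r \<odot>\<^bsub>quotient_module (ideal_module R J) N\<^esub> ((\<lambda>h. h \<oplus> g) ` N) = N \<longleftrightarrow> r \<otimes> g \<in> N"
    if "r \<in> carrier R" "g \<in> J" for r g
    unfolding scale using that assms(3) by (intro iff) auto
  then show ?thesis
    unfolding annihilator_def colon_ideal_def carr zero by auto
qed

section \<open>The radical of the colon ideal\<close>

lemma closed_neighborhood_cycle_subset:
  assumes "simple_graph n E" and "is_cycle E c"
  shows "closed_neighborhood E (set c) \<subseteq> {1..n}"
proof -
  have "x \<in> {1..n}" if "x \<in> set c" for x
  proof -
    obtain i where "i < length c" "x = c ! i"
      using \<open>x \<in> set c\<close> by (auto simp: in_set_conv_nth)
    then have "{x, c ! (Suc i mod length c)} \<in> E"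
      using assms(2) by (auto simp: cycle_edges_def is_cycle_def)
    then show ?thesis
      using assms(1) by (auto simp: simple_graph_def)
  qed
  moreover have "x \<in> {1..n}" if "{x, y} \<in> E" for x y
    using assms(1) that by (auto simp: simple_graph_def)
  ultimately show ?thesis
    by (auto simp: closed_neighborhood_def)
qed

text \<open>
  The monomial \<open>a\<close> of degree \<open>2 k - 1\<close>, supported on the short odd cycle, lies in the symbolic power.
  Some monomial \<open>w\<close> of \<open>f ^ M\<close> is supported on the support of \<open>u\<close>. If this support were disjoint
  from the closed neighbourhood of the cycle, all edges that can be packed into \<open>w + a\<close> would lie on
  the cycle, where there is weight for at most \<open>k - 1\<close> of them.
\<close>

lemma odd_cycle_obstruction:
  fixes f :: "('k::field) mpoly"
  assumes G: "simple_graph n E"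
    and c: "is_cycle E c" "odd (length c)" "length c \<le> 2 * k - 1"
    and f: "f ^ M \<in> colon_ideal (polynomial_ring n)
        (ideal_power (polynomial_ring n) (edge_ideal n E) k)
        (symbolic_power (polynomial_ring n) (edge_ideal n E) k)"
    and u: "u \<in> Poly_Mapping.keys f" "Poly_Mapping.keys u \<subseteq> {1..n}"
      "\<not> (\<exists>e \<in> E. e \<subseteq> Poly_Mapping.keys u)"
  shows "closed_neighborhood E (set c) \<inter> Poly_Mapping.keys u \<noteq> {}"
proof
  assume disj: "closed_neighborhood E (set c) \<inter> Poly_Mapping.keys u = {}"
  obtain l where l: "length c = 2 * l + 1"
    using c(2) oddE by blast
  have len: "3 \<le> length c" "distinct c" "cycle_edges c \<subseteq> E"
    using c(1) by (auto simp: is_cycle_def)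
  \<comment> \<open>A cover meets the cycle in at least \<open>Suc l\<close> vertices; \<open>r\<close> copies of an edge supply the rest.\<close>
  define r where "r = k - Suc l"
  have k: "k = Suc l + r"
    using c(3) l len(1) by (simp add: r_def)
  have "{c ! 0, c ! (Suc 0 mod length c)} \<in> cycle_edges c"
    using len(1) unfolding cycle_edges_def by (intro CollectI exI[of _ 0]) auto
  moreover have "Suc 0 mod length c = 1"
    using len(1) by (simp add: mod_less)
  ultimately have c01_edge: "{c ! 0, c ! 1} \<in> E"
    using len(3) by auto
  have "0 < length c" "1 < length c"
    using len(1) by linarith+
  then have c01: "c ! 0 \<in> set c" "c ! 1 \<in> set c" "c ! 0 \<noteq> c ! 1"
    using len(2) nth_mem nth_eq_iff_index_eq by (blast, blast, fastforce)
  define a :: "nat \<Rightarrow>\<^sub>0 nat" where "a = (\<Sum>i\<in>set c. Poly_Mapping.single i 1)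
      + (Poly_Mapping.single (c ! 0) r + Poly_Mapping.single (c ! 1) r)"
  define T where "T = {c ! 0, c ! 1}"
  have a: "Poly_Mapping.lookup a x = of_bool (x \<in> set c) + r * of_bool (x \<in> T)" for x
    using c01(3) by (auto simp: T_def a_def lookup_add lookup_sum lookup_single when_def of_bool_def)
  have sum_a: "sum (Poly_Mapping.lookup a) W = card (W \<inter> set c) + r * card (W \<inter> T)"
    if "finite W" for W
    using that by (simp add: a sum.distrib flip: sum_distrib_left)
  have cn: "set c \<subseteq> {1..n}"
    using closed_neighborhood_cycle_subset[OF G c(1)] by (auto simp: closed_neighborhood_def)
  have a_keys: "Poly_Mapping.keys a \<subseteq> set c"
    using c01 by (auto simp: in_keys_iff a T_def split: if_splits)
  have "k \<le> sum (Poly_Mapping.lookup a) W" if W: "W \<subseteq> {1..n}" "vertex_cover E W" for W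
  proof -
    have fin: "finite W"
      using W(1) by (rule finite_subset) simp
    have "Suc l \<le> card (W \<inter> set c)"
      using vertex_cover_cycle_card[OF c(1) W(2)] l by linarith
    moreover have "W \<inter> T \<noteq> {}"
      using W(2) c01_edge by (auto simp: vertex_cover_def T_def)
    then have "1 \<le> card (W \<inter> T)"
      using fin by (simp add: Suc_le_eq card_gt_0_iff)
    then have "r * 1 \<le> r * card (W \<inter> T)"
      by (rule mult_le_mono2)
    ultimately show ?thesis
      using sum_a[OF fin] k by linarith
  qed
  then have "Poly_Mapping.single a 1 \<in> symbolic_power (polynomial_ring n) (edge_ideal n E :: 'k mpoly set) k"
    unfolding symbolic_power_edge_ideal[OF G] using a_keys cn
    by (intro monomial_in_monomial_span) auto
  then have mem: "f ^ M * Poly_Mapping.single a 1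
      \<in> ideal_power (polynomial_ring n) (edge_ideal n E) k"
    using f by (auto simp: colon_ideal_def polynomial_ring_simps)
  obtain w where w: "w \<in> Poly_Mapping.keys (f ^ M)" "Poly_Mapping.keys w \<inter> - Poly_Mapping.keys u = {}"
    using keys_avoiding_power[OF u(1), of "- Poly_Mapping.keys u" M] by auto
  have "w + a \<in> Poly_Mapping.keys (f ^ M * Poly_Mapping.single a 1)"
    by (rule keys_monomial_mult[OF w(1)])
  then have packs: "packs E k (Poly_Mapping.lookup (w + a))"
    using mem unfolding power_edge_ideal[OF G] monomial_span_def by auto
  have "2 * k \<le> sum (Poly_Mapping.lookup (w + a)) (set c)"
  proof (rule packs_weight_lower_bound[OF packs])
    show "card e = 2" if "e \<in> E" for e
      using G that by (auto simp: simple_graph_def)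
    show "e \<subseteq> set c" if e: "e \<in> E" "\<forall>x \<in> e. 0 < Poly_Mapping.lookup (w + a) x" for e
    proof -
      obtain x y where xy: "e = {x, y}"
        using G e(1) by (auto simp: simple_graph_def card_2_iff)
      have "e \<subseteq> Poly_Mapping.keys (w + a)"
        using e(2) by (auto simp: in_keys_iff)
      then have "e \<subseteq> Poly_Mapping.keys u \<union> set c"
        using w(2) a_keys by (auto simp: keys_add_exponents)
      moreover have "\<not> e \<subseteq> Poly_Mapping.keys u"
        using u(3) e(1) by blast
      moreover have "x \<notin> Poly_Mapping.keys u" if "y \<in> set c"
        using disj that e(1) xy by (auto simp: closed_neighborhood_def)
      moreover have "y \<notin> Poly_Mapping.keys u" if "x \<in> set c"
        using disj that e(1) xy insert_commute[of x y "{}"] by (auto simp: closed_neighborhood_def)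
      ultimately show ?thesis
        using xy by auto
    qed
  qed simp
  also have "sum (Poly_Mapping.lookup (w + a)) (set c) = sum (Poly_Mapping.lookup a) (set c)"
  proof (rule sum.cong)
    fix x assume "x \<in> set c"
    then have "x \<notin> Poly_Mapping.keys w"
      using disj w(2) by (auto simp: closed_neighborhood_def)
    then show "Poly_Mapping.lookup (w + a) x = Poly_Mapping.lookup a x"
      by (simp add: lookup_add in_keys_iff)
  qed simp
  also have "\<dots> = length c + r * card T"
    using c01 len(2) by (simp add: sum_a distinct_card T_def Int_absorb1)
  also have "\<dots> = 2 * k - 1"
    using c01(3) l k by (simp add: T_def)
  finally show False
    using k by simp
qed

text \<open>
  A monomial \<open>w\<close> of \<open>f ^ M\<close> is divisible by the \<open>k\<close>-th power of a monomial \<open>u\<close> of \<open>f\<close>, so that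
  \<open>packs_if_meets_short_cycles\<close> applies to the product of \<open>w\<close> with any monomial of the symbolic
  power, with the support of \<open>u\<close> for \<open>B\<close>.
\<close>

lemma power_in_colon_ideal:
  fixes f :: "('k::field) mpoly"
  assumes G: "simple_graph n E"
    and f: "f \<in> carrier (polynomial_ring n)"
    and cycles: "\<And>u c. u \<in> Poly_Mapping.keys f \<Longrightarrow> c \<in> short_induced_odd_cycles E k \<Longrightarrow>
        (\<exists>e \<in> E. e \<subseteq> Poly_Mapping.keys u) \<or> closed_neighborhood E (set c) \<inter> Poly_Mapping.keys u \<noteq> {}"
    and M: "card (Poly_Mapping.keys f) * k < M"
  shows "f ^ M \<in> colon_ideal (polynomial_ring n)
        (ideal_power (polynomial_ring n) (edge_ideal n E) k)
        (symbolic_power (polynomial_ring n) (edge_ideal n E) k)"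
proof -
  interpret cring "polynomial_ring n :: 'k mpoly ring"
    by (rule cring_polynomial_ring)
  have fM: "f ^ M \<in> carrier (polynomial_ring n)"
    using nat_pow_closed[OF f, of M] by (simp add: polynomial_ring_pow)
  moreover have "f ^ M * g \<in> ideal_power (polynomial_ring n) (edge_ideal n E) k"
    if g: "g \<in> symbolic_power (polynomial_ring n) (edge_ideal n E) k" for g
  proof -
    have "packs E k (Poly_Mapping.lookup m)" if m: "m \<in> Poly_Mapping.keys (f ^ M * g)" for m
    proof -
      obtain w a where wa: "m = w + a" "w \<in> Poly_Mapping.keys (f ^ M)" "a \<in> Poly_Mapping.keys g"
        using m keys_mult[of "f ^ M" g] by blast
      obtain u where u: "u \<in> Poly_Mapping.keys f"
        "\<And>i. k * Poly_Mapping.lookup u i \<le> Poly_Mapping.lookup w i"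
        using keys_power_pigeonhole[OF wa(2) M] by blast
      show ?thesis
      proof (rule packs_if_meets_short_cycles[OF G, of "Poly_Mapping.keys u"])
        fix i assume "i \<in> Poly_Mapping.keys u"
        then have "k * 1 \<le> k * Poly_Mapping.lookup u i"
          by (intro mult_le_mono2) (simp add: in_keys_iff)
        then show "k \<le> Poly_Mapping.lookup m i"
          using u(2)[of i] unfolding wa(1) lookup_add by linarith
      next
        fix W assume W: "W \<subseteq> {1..n}" "vertex_cover E W"
        have "k \<le> sum (Poly_Mapping.lookup a) W"
          using g wa(3) W unfolding symbolic_power_edge_ideal[OF G] monomial_span_def by auto
        then show "k \<le> sum (Poly_Mapping.lookup m) W"
          by (simp add: wa(1) lookup_add sum.distrib)
      qed (rule cycles[OF u(1)])
    qed
    moreover have "f ^ M * g \<in> carrier (polynomial_ring n)"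
      using m_closed[OF fM, of g] g by (simp add: symbolic_power_def polynomial_ring_simps)
    ultimately show ?thesis
      unfolding power_edge_ideal[OF G] monomial_span_def by auto
  qed
  ultimately show ?thesis
    by (simp add: colon_ideal_def polynomial_ring_simps)
qed

lemma edge_ideal_plus_variables:
  assumes "simple_graph n E" and "A \<subseteq> {1..n}"
  shows "edge_ideal n E <+>\<^bsub>polynomial_ring n\<^esub> Idl\<^bsub>polynomial_ring n\<^esub> (pvar ` A)
      = {f \<in> carrier (polynomial_ring n). \<forall>u \<in> Poly_Mapping.keys (f :: ('k::field) mpoly).
          (\<exists>e \<in> E. e \<subseteq> Poly_Mapping.keys u) \<or> A \<inter> Poly_Mapping.keys u \<noteq> {}}"
  unfolding edge_ideal_eq[OF assms(1)] genideal_variables[OF assms(2)] variable_ideal_def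
    set_add_monomial_span
  by (auto simp: monomial_span_def Int_commute)

theorem theorem4p9:
  fixes n k :: nat
    and E :: "nat set set"
    and S :: "('k::field) mpoly ring"
    and I :: "'k mpoly set"
  assumes "simple_graph n E"
    and "k \<ge> 1"
    and "S = polynomial_ring n"
    and "I = edge_ideal n E"
  shows "radical S (colon_ideal S (ideal_power S I k) (symbolic_power S I k))
           = radical S (annihilator S
               (quotient_module (ideal_module S (symbolic_power S I k)) (ideal_power S I k)))
       \<and> radical S (annihilator S
               (quotient_module (ideal_module S (symbolic_power S I k)) (ideal_power S I k)))
           = carrier S \<inter> (\<Inter>C \<in> short_induced_odd_cycles E k.
               I <+>\<^bsub>S\<^esub> Idl\<^bsub>S\<^esub> (pvar ` closed_neighborhood E (set C)))"
proof -
  let ?colon = "colon_ideal S (ideal_power S I k) (symbolic_power S I k)"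
  have sum: "f \<in> I <+>\<^bsub>S\<^esub> Idl\<^bsub>S\<^esub> (pvar ` closed_neighborhood E (set c)) \<longleftrightarrow>
      f \<in> carrier S \<and> (\<forall>u \<in> Poly_Mapping.keys f.
        (\<exists>e \<in> E. e \<subseteq> Poly_Mapping.keys u) \<or> closed_neighborhood E (set c) \<inter> Poly_Mapping.keys u \<noteq> {})"
    if "c \<in> short_induced_odd_cycles E k" for f c
  proof -
    have "is_cycle E c"
      using that by (simp add: short_induced_odd_cycles_def is_induced_cycle_def)
    then show ?thesis
      unfolding assms(3,4)
      by (subst edge_ideal_plus_variables[OF assms(1) closed_neighborhood_cycle_subset[OF assms(1)]]) auto
  qed
  have "ideal (ideal_power S I k) S"
    unfolding assms(3,4) power_edge_ideal[OF assms(1)]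
    by (rule ideal_monomial_span) (auto simp: lookup_add elim: packs_mono)
  then have "annihilator S (quotient_module (ideal_module S (symbolic_power S I k)) (ideal_power S I k)) = ?colon"
    by (intro annihilator_quotient_eq_colon_ideal) (auto simp: assms(3) cring_polynomial_ring symbolic_power_def)
  moreover have "radical S ?colon = carrier S \<inter> (\<Inter>C \<in> short_induced_odd_cycles E k.
      I <+>\<^bsub>S\<^esub> Idl\<^bsub>S\<^esub> (pvar ` closed_neighborhood E (set C)))" (is "_ = ?rhs")
  proof (intro equalityI subsetI)
    fix f assume "f \<in> radical S ?colon"
    then obtain M where f: "f \<in> carrier S" "f ^ M \<in> ?colon"
      by (auto simp: radical_def assms(3) polynomial_ring_pow)
    have "closed_neighborhood E (set c) \<inter> Poly_Mapping.keys u \<noteq> {}"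
      if "c \<in> short_induced_odd_cycles E k" "u \<in> Poly_Mapping.keys f"
        "\<not> (\<exists>e \<in> E. e \<subseteq> Poly_Mapping.keys u)" for c u
      using that f assms(3,4)
      by (intro odd_cycle_obstruction[OF assms(1), of c k f M])
        (auto simp: short_induced_odd_cycles_def is_induced_cycle_def in_polynomial_ring_iff)
    then show "f \<in> ?rhs"
      using f(1) sum by blast
  next
    fix f assume f: "f \<in> ?rhs"
    have "f ^ Suc (card (Poly_Mapping.keys f) * k) \<in> ?colon"
      unfolding assms(3,4)
      by (rule power_in_colon_ideal[OF assms(1)]) (use f sum assms(3) in auto)
    then show "f \<in> radical S ?colon"
      using f by (auto simp: radical_def assms(3) polynomial_ring_pow simp del: power_Suc)
  qed
  ultimately show ?thesis
    by simp
qed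

end
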